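(* Given a non-separating simple arrangement $\mathcal{S}$ of Jordan curves, a minimum-size set of points meeting the open interior and the open exterior of every curve in $\mathcal{S}$ can be computed in polynomial time.
   Context: A Jordan curve is a simple closed curve in the plane; its interior (resp. exterior) is the bounded (resp. unbounded) component of its complement. An arrangement of Jordan curves is a finite set of Jordan curves any two of which meet in finitely many points; it is simple if no point of the plane lies on more than two of its curves. For a Jordan curve $S$ and a point $p\notin S$, $S(p)$ denotes the closure of the side of $S$ not containing $p$. The arrangement $\mathcal{S}$ is non-separating if for every $p\in\mathbb{R}^2\setminus\bigcup\mathcal{S}$ and every $\mathcal{S}'\subseteq\mathcal{S}$, the set $\mathbb{R}^2\setminus\bigcup_{S\in\mathcal{S}'}S(p)$ is connected. *)

theory Defs
  imports "HOL-Analysis.Analysis" "HOL-Computational_Algebra.Polynomial"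
begin

section \<open>Arrangements of Jordan curves\<close>

text \<open>
  The plane is the type \<^typ>\<open>complex\<close>, as in the library's Jordan curve theorem. For a Jordan
  curve \<open>S\<close>, \<^const>\<open>inside\<close> and \<^const>\<open>outside\<close> are the bounded and the unbounded component
  of \<open>- S\<close>; both are open.
\<close>

definition Jordan_curve :: "complex set \<Rightarrow> bool" where
  "Jordan_curve S \<longleftrightarrow> (\<exists>g. simple_path g \<and> pathfinish g = pathstart g \<and> path_image g = S)"

definition arrangement :: "complex set set \<Rightarrow> bool" where
  "arrangement \<S> \<longleftrightarrow>
     finite \<S> \<and> (\<forall>S\<in>\<S>. Jordan_curve S) \<and> (\<forall>S\<in>\<S>. \<forall>T\<in>\<S>. S \<noteq> T \<longrightarrow> finite (S \<inter> T))"

definition simple_arrangement :: "complex set set \<Rightarrow> bool" where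
  "simple_arrangement \<S> \<longleftrightarrow> arrangement \<S> \<and> (\<forall>p. card {S \<in> \<S>. p \<in> S} \<le> 2)"

text \<open>Only meaningful for \<open>p \<notin> S\<close>.\<close>

definition far_side :: "complex set \<Rightarrow> complex \<Rightarrow> complex set" where
  "far_side S p = closure (if p \<in> inside S then outside S else inside S)"

definition non_separating :: "complex set set \<Rightarrow> bool" where
  "non_separating \<S> \<longleftrightarrow>
     (\<forall>p. p \<notin> \<Union>\<S> \<longrightarrow> (\<forall>\<T>\<subseteq>\<S>. connected (- (\<Union>S\<in>\<T>. far_side S p))))"

definition hits_both_sides :: "complex set set \<Rightarrow> complex set \<Rightarrow> bool" where
  "hits_both_sides \<S> P \<longleftrightarrow> (\<forall>S\<in>\<S>. P \<inter> inside S \<noteq> {} \<and> P \<inter> outside S \<noteq> {})"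

definition minimum_hitting_set :: "complex set set \<Rightarrow> complex set \<Rightarrow> bool" where
  "minimum_hitting_set \<S> P \<longleftrightarrow>
     finite P \<and> hits_both_sides \<S> P \<and> (\<forall>Q. finite Q \<and> hits_both_sides \<S> Q \<longrightarrow> card P \<le> card Q)"


section \<open>Polynomial time\<close>

text \<open>
  The machine model is the unit-cost random access machine with addition, truncated subtraction
  and indirect addressing, written as structured programs. The memory is a fixed finite number
  of named unbounded arrays of natural numbers (the names occurring in the program); a scalar
  variable is entry 0 of an array. Since an expression has constant size and there is no
  multiplication, each step lengthens the binary representation of the largest stored number
  by at most a constant, so that polynomial time here coincides with polynomial time on Turing
  machines.
\<close>

type_synonym array_name = string
type_synonym memory = "array_name \<Rightarrow> nat \<Rightarrow> nat"

datatype expr =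
    Const nat
  | Read array_name expr
  | Add expr expr
  | Sub expr expr

primrec expr_val :: "expr \<Rightarrow> memory \<Rightarrow> nat" where
  "expr_val (Const n) M = n"
| "expr_val (Read x e) M = M x (expr_val e M)"
| "expr_val (Add e f) M = expr_val e M + expr_val f M"
| "expr_val (Sub e f) M = expr_val e M - expr_val f M"

datatype program =
    Skip
  | Write array_name expr expr
  | Seq program program
  | Cond expr program program
  | While expr program

text \<open>
  \<open>exec c M t M'\<close>: started in memory \<open>M\<close>, the program \<open>c\<close> halts after \<open>t\<close> steps in memory \<open>M'\<close>.
  Tests succeed iff the value is nonzero.
\<close>

inductive exec :: "program \<Rightarrow> memory \<Rightarrow> nat \<Rightarrow> memory \<Rightarrow> bool" where
  Skip: "exec Skip M 1 M"
| Write: "exec (Write x e f) M 1 (M(x := (M x)(expr_val e M := expr_val f M)))"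
| Seq: "exec c M t M' \<Longrightarrow> exec d M' u M'' \<Longrightarrow> exec (Seq c d) M (t + u) M''"
| CondTrue: "expr_val e M \<noteq> 0 \<Longrightarrow> exec c M t M' \<Longrightarrow> exec (Cond e c d) M (1 + t) M'"
| CondFalse: "expr_val e M = 0 \<Longrightarrow> exec d M t M' \<Longrightarrow> exec (Cond e c d) M (1 + t) M'"
| WhileFalse: "expr_val e M = 0 \<Longrightarrow> exec (While e c) M 1 M"
| WhileTrue: "expr_val e M \<noteq> 0 \<Longrightarrow> exec c M t M' \<Longrightarrow> exec (While e c) M' u M''
    \<Longrightarrow> exec (While e c) M (1 + t + u) M''"

definition input_memory :: "nat list \<Rightarrow> memory" where
  "input_memory w = (\<lambda>x i. if x = ''input'' \<and> i < length w then w ! i else 0)"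

text \<open>Entry 0 of the output array holds the length of the output.\<close>

definition output_of :: "memory \<Rightarrow> nat list" where
  "output_of M = map (\<lambda>i. M ''output'' (Suc i)) [0..<M ''output'' 0]"

text \<open>
  A problem is given by a set of instances, an encoding of instances as words of natural
  numbers, and a relation between instances and acceptable outputs. The size of an instance is
  the length of its word; this is at most its bit length.
\<close>

definition solvable_in_polynomial_time ::
  "'i set \<Rightarrow> ('i \<Rightarrow> nat list) \<Rightarrow> ('i \<Rightarrow> nat list \<Rightarrow> bool) \<Rightarrow> bool" where
  "solvable_in_polynomial_time I enc R \<longleftrightarrow>
     (\<exists>(c :: program) (p :: nat poly). \<forall>i\<in>I. \<exists>t M.
        exec c (input_memory (enc i)) t M \<and> t \<le> poly p (length (enc i)) \<and> R i (output_of M))"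


section \<open>Presenting an arrangement to a machine\<close>

text \<open>
  An arrangement is presented combinatorially: its curves and its cells (the components of the
  complement of the union of the curves, finitely many for an arrangement) are numbered
  arbitrarily, and the machine is told on which side of which curve each cell lies. This
  table is computable in polynomial time from the planar map formed by the curves, so a
  polynomial-time algorithm for this input yields one for the planar map. As every arrangement
  with \<open>n\<close> curves and \<open>m\<close> cells has \<open>m \<ge> 1\<close>, and \<open>m = 1\<close> if \<open>n = 0\<close>, the length \<open>2 + m * n\<close> of
  the code bounds \<open>m\<close> and \<open>n\<close>.
\<close>

definition cells :: "complex set set \<Rightarrow> complex set set" where
  "cells \<S> = components (- \<Union>\<S>)"

type_synonym presentation = "complex set list \<times> complex set list"

definition presents :: "presentation \<Rightarrow> complex set set \<Rightarrow> bool" where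
  "presents = (\<lambda>(Ss, Cs) \<S>. distinct Ss \<and> set Ss = \<S> \<and> distinct Cs \<and> set Cs = cells \<S>)"

definition code_of :: "presentation \<Rightarrow> nat list" where
  "code_of = (\<lambda>(Ss, Cs).
     [length Cs, length Ss] @ concat (map (\<lambda>C. map (\<lambda>S. of_bool (C \<subseteq> inside S)) Ss) Cs))"

text \<open>
  A list \<open>js\<close> of cell numbers describes a point set up to the choice of the points inside these
  cells.
\<close>

definition point_set_described :: "presentation \<Rightarrow> nat list \<Rightarrow> complex set \<Rightarrow> bool" where
  "point_set_described = (\<lambda>(Ss, Cs) js P. distinct js \<and> set js \<subseteq> {..<length Cs} \<and>
     (\<exists>q. (\<forall>j\<in>set js. q j \<in> Cs ! j) \<and> P = q ` set js))"

end

theory Submission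
  imports Defs
begin

text \<open>
  Fix a point \<open>p\<close> off the curves. The curves' sides not containing \<open>p\<close> are discs, and an inversion
  makes them bounded. By non-separation no union of closed discs separates the plane, so by
  Janiszewski's theorem connected unions of discs have connected intersections. Hence pairwise
  intersecting discs have a common point, and the intersection graph of the discs is chordal: some
  disc and all discs that meet it have a common point. As there are no triple points, this holds
  for the open discs as well. Choosing such a common point and discarding the discs hit by it,
  until none is left, yields a minimum hitting set of the discs, certified by the pairwise disjoint
  discs that gave rise to the choices. Together with \<open>p\<close> it is a smallest solution among those with
  a point in the cell of \<open>p\<close>; it remains to try all cells for \<open>p\<close>.
\<close>

section \<open>Discs whose unions do not separate the plane\<close>

text \<open>Janiszewski's theorem in its dual form says that two compact connected sets whose union
  has connected complement meet in a connected set. Compactness is why the far sides are first made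
  bounded; the price is that infinity may become an ordinary point of a disc. It also forces an
  argument with closed discs, while solution points must lie in open sides. Two facts bridge this
  gap: disjoint open discs touch in finitely many points only, and a point on two curves lies on no
  third. Chordality enters only as a guarantee of progress: the program computes no elimination
  order but searches all pairs of a curve and a cell. A competing solution may have points on
  curves; these are traded for cells without losing a side.\<close>

text \<open>\<open>Q \<union> (F - P)\<close> is still closed, so finitely many stray touching
  points cannot make up for a missing common point of \<open>P\<close> and \<open>Q\<close>.\<close>

lemma connected_closed_parts_upto_finite:
  fixes X :: "complex set"
  assumes "connected X" "X = P \<union> Q \<union> F" "closed P" "closed Q" "finite F" "P \<noteq> {}" "Q \<noteq> {}"
  shows "P \<inter> Q \<noteq> {}"
proof
  assume PQ: "P \<inter> Q = {}"
  have "closed (Q \<union> (F - P))"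
    using assms(4,5) by (simp add: closed_Un finite_imp_closed)
  moreover have "P \<inter> (Q \<union> (F - P)) \<inter> X = {}" "X \<subseteq> P \<union> (Q \<union> (F - P))"
      "P \<inter> X \<noteq> {}" "(Q \<union> (F - P)) \<inter> X \<noteq> {}"
    using PQ assms by auto
  ultimately show False
    using assms(1,3) unfolding connected_closed by blast
qed

text \<open>Induction by restriction to one member: the traces \<open>E a \<inter> E i\<close>
  inherit every hypothesis. They meet pairwise because \<open>E a\<close> cuts the connected set
  \<open>E i \<union> E j\<close> in a connected set made of two closed pieces. The complement of a
  union of traces is a union of two connected complements, which meet since compact sets do not fill
  the plane.\<close>

lemma Helly_connected_unions:
  fixes E :: "'i \<Rightarrow> complex set"
  assumes "finite J" "J \<noteq> {}"
    and "\<And>i. i \<in> J \<Longrightarrow> compact (E i)" "\<And>i. i \<in> J \<Longrightarrow> connected (E i)"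
    and "\<And>K. K \<subseteq> J \<Longrightarrow> connected (- (\<Union>i\<in>K. E i))"
    and "\<And>i j. i \<in> J \<Longrightarrow> j \<in> J \<Longrightarrow> E i \<inter> E j \<noteq> {}"
  shows "(\<Inter>i\<in>J. E i) \<noteq> {}"
  using assms
proof (induction J arbitrary: E rule: finite_ne_induct)
  case (singleton a)
  then show ?case by auto
next
  case (insert a J)
  have cpt: "compact (E i)" and conn: "connected (E i)" if "i \<in> insert a J" for i
    using insert.prems that by blast+
  have conn2: "connected (E i \<inter> E j)" if "i \<in> insert a J" "j \<in> insert a J" for i j
  proof (rule Janiszewski_dual)
    have "connected (- (\<Union>k\<in>{i, j}. E k))"
      using that by (intro insert.prems(3)) auto
    then show "connected (- (E i \<union> E j))" by simp
  qed (use that cpt conn in auto)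
  have triple: "E a \<inter> E i \<inter> E j \<noteq> {}" if ij: "i \<in> J" "j \<in> J" for i j
  proof
    assume empty: "E a \<inter> E i \<inter> E j = {}"
    have meet: "E i \<inter> E j \<noteq> {}" "E a \<inter> E i \<noteq> {}" "E a \<inter> E j \<noteq> {}"
      using ij insert.prems(4) by auto
    have "connected (E a \<inter> (E i \<union> E j))"
    proof (rule Janiszewski_dual)
      show "compact (E i \<union> E j)" using ij cpt by auto
      show "connected (E i \<union> E j)"
        using ij meet conn by (intro connected_Un) auto
      have "connected (- (\<Union>k\<in>{a, i, j}. E k))"
        using ij by (intro insert.prems(3)) auto
      then show "connected (- (E a \<union> (E i \<union> E j)))" by simp
    qed (use cpt conn in auto)
    moreover have "closed (E a \<inter> E i)" "closed (E a \<inter> E j)"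
      using ij cpt by (auto intro!: compact_imp_closed)
    ultimately have "(E a \<inter> E i) \<inter> (E a \<inter> E j) \<noteq> {}"
      using meet connected_closed_parts_upto_finite[of "E a \<inter> (E i \<union> E j)" "E a \<inter> E i" "E a \<inter> E j" "{}"]
      by (simp add: Int_Un_distrib)
    then show False using empty by blast
  qed
  have "(\<Inter>i\<in>J. E a \<inter> E i) \<noteq> {}"
  proof (rule insert.IH)
    show "compact (E a \<inter> E i)" if "i \<in> J" for i
      using that cpt by (simp add: compact_Int)
    show "connected (E a \<inter> E i)" if "i \<in> J" for i
      using that conn2 by simp
    show "connected (- (\<Union>i\<in>K. E a \<inter> E i))" if "K \<subseteq> J" for K
    proof -
      let ?U = "\<Union>i\<in>K. E i"
      have "connected (- (\<Union>i\<in>{a}. E i))" "connected (- ?U)"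
        using that by (intro insert.prems(3); blast)+
      moreover have "- E a \<inter> - ?U \<noteq> {}"
      proof -
        have "finite K" using that insert.hyps finite_subset by blast
        then have "compact (E a \<union> ?U)"
          using that cpt by (intro compact_Un compact_UN) auto
        then have "E a \<union> ?U \<noteq> UNIV"
          using not_compact_UNIV by metis
        then show ?thesis by blast
      qed
      ultimately have "connected (- E a \<union> - ?U)"
        by (intro connected_Un) auto
      moreover have "- E a \<union> - ?U = - (\<Union>i\<in>K. E a \<inter> E i)" by blast
      ultimately show ?thesis by simp
    qed
    show "(E a \<inter> E i) \<inter> (E a \<inter> E j) \<noteq> {}" if "i \<in> J" "j \<in> J" for i j
      using triple[OF that] by blast
  qed
  then show ?case using insert.hyps by auto
qed

section \<open>Simplicial vertices\<close>

lemma rtranclp_component_closed: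
  assumes "(\<lambda>x y. r x y \<and> y \<in> A)\<^sup>*\<^sup>* a b" "a \<in> A"
  shows "b \<in> A"
  using assms by (induction rule: rtranclp_induct) auto

text \<open>
  The property of chordal graphs that Dirac's proof of the existence of simplicial vertices uses:
  two neighbours of \<open>v\<close> are adjacent if both have a neighbour in one connected set \<open>C\<close> that contains
  neither \<open>v\<close> nor a neighbour of \<open>v\<close>.
\<close>

definition separators_adjacent :: "('i \<Rightarrow> 'i \<Rightarrow> bool) \<Rightarrow> 'i set \<Rightarrow> bool" where
  "separators_adjacent r J \<longleftrightarrow>
     (\<forall>v\<in>J. \<forall>C\<subseteq>J. \<forall>a\<in>C. \<forall>x\<in>J. \<forall>y\<in>J.
        (\<forall>w\<in>C. (\<lambda>x y. r x y \<and> y \<in> C)\<^sup>*\<^sup>* a w \<and> \<not> r v w) \<and> r v x \<and> r v y \<and>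
        (\<exists>w\<in>C. r x w) \<and> (\<exists>w\<in>C. r y w) \<longrightarrow> r x y)"

lemma separators_adjacent_subset:
  assumes "separators_adjacent r J" "A \<subseteq> J"
  shows "separators_adjacent r A"
  unfolding separators_adjacent_def
proof (intro ballI allI impI)
  fix v C a x y
  assume "v \<in> A" "C \<subseteq> A" "a \<in> C" "x \<in> A" "y \<in> A"
    and *: "(\<forall>w\<in>C. (\<lambda>x y. r x y \<and> y \<in> C)\<^sup>*\<^sup>* a w \<and> \<not> r v w) \<and> r v x \<and> r v y \<and>
      (\<exists>w\<in>C. r x w) \<and> (\<exists>w\<in>C. r y w)"
  then have "v \<in> J" "C \<subseteq> J" "x \<in> J" "y \<in> J" using assms(2) by auto
  then show "r x y"
    using assms(1)[unfolded separators_adjacent_def, THEN bspec[of _ _ v], THEN spec[of _ C], THEN mp,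
        THEN bspec[of _ _ a], THEN bspec[of _ _ x], THEN bspec[of _ _ y], THEN mp, OF _ _ _ _ _ *]
      \<open>a \<in> C\<close> by iprover
qed

text \<open>Dirac's argument. Asking for a vertex not adjacent to \<open>v\<close> keeps the
  induction going: applied to some \<open>x\<close> in the clique \<open>N\<close>, it forces the
  vertex found out of \<open>N\<close> and into \<open>C\<close>. Vertices of \<open>C\<close> have
  all their neighbours in \<open>C \<union> N\<close>, so being simplicial there suffices.\<close>

lemma simplicial_vertex_away:
  fixes r :: "'i \<Rightarrow> 'i \<Rightarrow> bool"
  assumes "finite J" "symp r" "reflp_on J r" "separators_adjacent r J"
    and "v \<in> J" "u \<in> J" "\<not> r v u"
  shows "\<exists>w\<in>J. \<not> r v w \<and> (\<forall>x\<in>J. \<forall>y\<in>J. r w x \<longrightarrow> r w y \<longrightarrow> r x y)"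
  using assms
proof (induction "card J" arbitrary: J v u rule: less_induct)
  case less
  let ?simplicial = "\<lambda>A w. \<forall>x\<in>A. \<forall>y\<in>A. r w x \<longrightarrow> r w y \<longrightarrow> r x y"
  have sym: "r x y \<Longrightarrow> r y x" for x y
    using less.prems(2) by (rule sympD)
  have refl: "r v v"
    using less.prems(3,5) by (rule reflp_onD)
  have IH: "\<exists>w\<in>A. \<not> r x w \<and> ?simplicial A w" if "A \<subset> J" "x \<in> A" "y \<in> A" "\<not> r x y" for A x y
  proof (rule less.hyps)
    show "card A < card J" "finite A"
      using that less.prems(1) by (auto intro: psubset_card_mono finite_subset)
    show "reflp_on A r"
      using less.prems(3) that(1) by (auto intro: reflp_on_subset)
    show "separators_adjacent r A"
      using less.prems(4) that(1) by (auto intro: separators_adjacent_subset)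
  qed (use that less.prems(2) in auto)
  \<comment> \<open>\<open>C\<close> is the component of \<open>u\<close> among the non-neighbours
    of \<open>v\<close>, and \<open>N\<close> separates it from \<open>v\<close>.\<close>
  define A where "A = {w \<in> J. \<not> r v w}"
  define C where "C = {w. (\<lambda>x y. r x y \<and> y \<in> A)\<^sup>*\<^sup>* u w}"
  define N where "N = {x \<in> J. r v x \<and> (\<exists>w\<in>C. r x w)}"
  have "u \<in> A" "u \<in> C" using less.prems by (auto simp: A_def C_def)
  have CA: "C \<subseteq> A"
    using rtranclp_component_closed[of r A u] \<open>u \<in> A\<close> by (auto simp: C_def)
  have Cconn: "(\<lambda>x y. r x y \<and> y \<in> C)\<^sup>*\<^sup>* u w" if "w \<in> C" for w
  proof -
    have "(\<lambda>x y. r x y \<and> y \<in> A)\<^sup>*\<^sup>* u w" using that by (simp add: C_def)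
    then show ?thesis
    proof (induction rule: rtranclp_induct)
      case (step y z)
      then have "z \<in> C" by (auto simp: C_def intro: rtranclp.rtrancl_into_rtrancl)
      with step show ?case by (auto intro: rtranclp.rtrancl_into_rtrancl)
    qed simp
  qed
  have Cnbr: "x \<in> C \<union> N" if "w \<in> C" "r w x" "x \<in> J" for w x
  proof (cases "r v x")
    case True
    with that sym[of w x] show ?thesis by (auto simp: N_def)
  next
    case False
    with that have "x \<in> C"
      unfolding C_def by (auto intro: rtranclp.rtrancl_into_rtrancl simp: A_def)
    then show ?thesis by simp
  qed
  have clique: "r x y" if "x \<in> N" "y \<in> N" for x y
  proof -
    have "\<forall>w\<in>C. (\<lambda>x y. r x y \<and> y \<in> C)\<^sup>*\<^sup>* u w \<and> \<not> r v w" "C \<subseteq> J"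
      using Cconn CA by (auto simp: A_def)
    then show ?thesis
      using that \<open>u \<in> C\<close>
      by (intro less.prems(4)[unfolded separators_adjacent_def, THEN bspec[of _ _ v], THEN spec[of _ C],
            THEN mp, THEN bspec[of _ _ u], THEN bspec[of _ _ x], THEN bspec[of _ _ y], THEN mp]
          conjI less.prems(5)) (auto simp: N_def)
  qed
  have lift: "?simplicial J w" if "w \<in> C" "?simplicial (C \<union> N) w" for w
  proof (intro ballI impI)
    fix x y assume "x \<in> J" "y \<in> J" "r w x" "r w y"
    then show "r x y" using that Cnbr[OF \<open>w \<in> C\<close>] by simp
  qed
  have "v \<notin> C \<union> N"
    using CA refl by (auto simp: A_def N_def)
  then have sub: "C \<union> N \<subset> J" using CA less.prems(5) by (auto simp: A_def N_def)
  have "\<exists>w\<in>C. ?simplicial (C \<union> N) w"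
  proof (cases "\<exists>x\<in>N. \<exists>y\<in>C \<union> N. \<not> r x y")
    case True
    then obtain x y where "x \<in> N" "y \<in> C \<union> N" "\<not> r x y" by blast
    then obtain w where w: "w \<in> C \<union> N" "\<not> r x w" "?simplicial (C \<union> N) w"
      using IH[OF sub, of x y] by auto
    have "w \<in> C" using w(1,2) clique[OF \<open>x \<in> N\<close>] by blast
    with w(3) show ?thesis by (rule bexI)
  next
    \<comment> \<open>Every vertex of \<open>N\<close> is now adjacent to all of
      \<open>C \<union> N\<close>, so it is enough to be simplicial within \<open>C\<close>.\<close>
    case False
    then have univ: "r x y" "r y x" if "x \<in> N" "y \<in> C \<union> N" for x y
      using that by (blast, blast intro: sym)
    have "\<exists>w\<in>C. ?simplicial C w"
    proof (cases "\<exists>x\<in>C. \<exists>y\<in>C. \<not> r x y")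
      case True
      then obtain x y where "x \<in> C" "y \<in> C" "\<not> r x y" by blast
      moreover have "C \<subset> J" using sub by blast
      ultimately show ?thesis using IH[of C x y] by auto
    next
      case False
      then show ?thesis using \<open>u \<in> C\<close> by (intro bexI[of _ u]) auto
    qed
    then obtain w where w: "w \<in> C" "?simplicial C w" by (elim bexE)
    have "?simplicial (C \<union> N) w"
    proof (intro ballI impI)
      fix x y assume "x \<in> C \<union> N" "y \<in> C \<union> N" "r w x" "r w y"
      then show "r x y" using w(2) univ by (cases "x \<in> N \<or> y \<in> N") auto
    qed
    then show ?thesis using w(1) by (rule bexI)
  qed
  then obtain w where w: "w \<in> C" "?simplicial (C \<union> N) w" by (elim bexE)
  have "?simplicial J w" by (rule lift[OF w])
  moreover have "\<not> r v w" "w \<in> J" using CA w(1) by (auto simp: A_def)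
  ultimately show ?case by (intro bexI conjI)
qed

section \<open>Families of discs whose boundaries cross finitely often\<close>

text \<open>What is kept of the far sides after the inversion: \<open>U i\<close> is the open disc,
  \<open>S i\<close> the image of its curve, and \<open>connected_compl\<close> carries
  non-separation.\<close>

locale disc_family =
  fixes I :: "'i set" and U S :: "'i \<Rightarrow> complex set"
  assumes finite_I: "finite I"
    and open_U: "i \<in> I \<Longrightarrow> open (U i)"
    and bounded_U: "i \<in> I \<Longrightarrow> bounded (U i)"
    and connected_U: "i \<in> I \<Longrightarrow> connected (U i)"
    and U_nonempty: "i \<in> I \<Longrightarrow> U i \<noteq> {}"
    and closure_U: "i \<in> I \<Longrightarrow> closure (U i) = U i \<union> S i"
    and finite_S: "i \<in> I \<Longrightarrow> j \<in> I \<Longrightarrow> i \<noteq> j \<Longrightarrow> finite (S i \<inter> S j)"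
    and triple_S: "i \<in> I \<Longrightarrow> j \<in> I \<Longrightarrow> k \<in> I \<Longrightarrow> i \<noteq> j \<Longrightarrow> i \<noteq> k \<Longrightarrow> j \<noteq> k \<Longrightarrow>
          S i \<inter> S j \<inter> S k = {}"
    and connected_compl: "K \<subseteq> I \<Longrightarrow> connected (- (\<Union>i\<in>K. closure (U i)))"
begin

abbreviation E :: "'i \<Rightarrow> complex set" where "E i \<equiv> closure (U i)"

lemma compact_E: "i \<in> I \<Longrightarrow> compact (E i)"
  using bounded_U compact_closure by blast

lemma connected_E: "i \<in> I \<Longrightarrow> connected (E i)"
  using connected_U connected_imp_connected_closure by blast

lemma U_subset_E: "U i \<subseteq> E i"
  by (rule closure_subset)

lemma E_Int_nonempty: "U i \<inter> U j \<noteq> {} \<Longrightarrow> E i \<inter> E j \<noteq> {}"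
  using U_subset_E[of i] U_subset_E[of j] by blast

lemma disjoint_E_Int:
  assumes "i \<in> I" "j \<in> I" "U i \<inter> U j = {}"
  shows "E i \<inter> E j \<subseteq> S i \<inter> S j"
proof -
  have "U i \<inter> E j = {}" "U j \<inter> E i = {}"
    using assms open_Int_closure_eq_empty[OF open_U, of i "U j"]
      open_Int_closure_eq_empty[OF open_U, of j "U i"] by (auto simp: Int_commute)
  then show ?thesis using closure_U assms by blast
qed

text \<open>By Janiszewski \<open>E i \<inter> E j\<close> is connected. Its points outside the
  closure of \<open>U i \<inter> U j\<close> lie on both curves, so they are finitely many and would
  split off. Used to push a common boundary point into both open discs.\<close>

lemma E_Int_subset_closure:
  assumes ij: "i \<in> I" "j \<in> I" and meet: "U i \<inter> U j \<noteq> {}"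
  shows "E i \<inter> E j \<subseteq> closure (U i \<inter> U j)"
proof (cases "i = j")
  case False
  let ?X = "E i \<inter> E j" and ?P = "closure (U i \<inter> U j)"
  have conn: "connected ?X"
  proof (rule Janiszewski_dual)
    have "connected (- (\<Union>k\<in>{i, j}. E k))"
      using ij by (intro connected_compl) auto
    then show "connected (- (E i \<union> E j))" by simp
  qed (use ij compact_E connected_E in auto)
  have sub: "?P \<subseteq> ?X" by (simp add: closure_mono)
  have "U i \<inter> E j \<subseteq> ?P" "U j \<inter> E i \<subseteq> ?P"
    using open_Int_closure_subset[OF open_U, of i "U j"]
      open_Int_closure_subset[OF open_U, of j "U i"] ij by (auto simp: Int_commute)
  then have "?X - ?P \<subseteq> S i \<inter> S j"
    using ij closure_U by blast
  then have fin: "finite (?X - ?P)"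
    using finite_S ij False finite_subset by blast
  have "?X - ?P = {}"
  proof (rule ccontr)
    assume "?X - ?P \<noteq> {}"
    moreover have "?X = ?P \<union> (?X - ?P) \<union> {}" "?P \<noteq> {}"
      using sub meet by auto
    ultimately have "?P \<inter> (?X - ?P) \<noteq> {}"
      using fin connected_closed_parts_upto_finite[OF conn, of ?P "?X - ?P" "{}"]
      by (simp add: finite_imp_closed)
    then show False by blast
  qed
  then show ?thesis by blast
qed auto

text \<open>A common point of the closed discs misses at most two of the open discs, as no three
  curves meet. By \<open>E_Int_subset_closure\<close> it can be moved into these two without leaving
  the others.\<close>

lemma Helly:
  assumes J: "J \<subseteq> I" "J \<noteq> {}"
    and meet: "\<And>i j. i \<in> J \<Longrightarrow> j \<in> J \<Longrightarrow> U i \<inter> U j \<noteq> {}"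
  shows "(\<Inter>i\<in>J. U i) \<noteq> {}"
proof -
  have finJ: "finite J" using J finite_I finite_subset by blast
  have "(\<Inter>i\<in>J. E i) \<noteq> {}"
  proof (rule Helly_connected_unions)
    show "E i \<inter> E j \<noteq> {}" if "i \<in> J" "j \<in> J" for i j
      using meet[OF that] by (rule E_Int_nonempty)
  qed (use J finJ compact_E connected_E connected_compl in auto)
  then obtain x where x: "\<And>i. i \<in> J \<Longrightarrow> x \<in> E i" by blast
  define B where "B = {i \<in> J. x \<notin> U i}"
  \<comment> \<open>\<open>a = b\<close> is allowed, for the case that at most one open disc misses
    \<open>x\<close>.\<close>
  obtain a b where ab: "a \<in> J" "b \<in> J" "B \<subseteq> {a, b}"
  proof -
    have inS: "x \<in> S i" if "i \<in> B" for i
      using that x[of i] closure_U[of i] J by (auto simp: B_def)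
    show thesis
    proof (cases "B = {}")
      case True
      then show ?thesis using that J by blast
    next
      case False
      then obtain a where a: "a \<in> B" by blast
      show ?thesis
      proof (cases "B = {a}")
        case True
        then show ?thesis using that[of a a] by (auto simp: B_def)
      next
        case False
        then obtain b where b: "b \<in> B" "b \<noteq> a" using a by blast
        have "c \<in> {a, b}" if c: "c \<in> B" for c
        proof (rule ccontr)
          assume "c \<notin> {a, b}"
          then have "S a \<inter> S b \<inter> S c = {}"
            using a b c J by (intro triple_S) (auto simp: B_def)
          then show False using inS a b c by blast
        qed
        then show ?thesis using that[of a b] a b by (auto simp: B_def)
      qed
    qed
  qed
  let ?W = "\<Inter>i\<in>J - {a, b}. U i"
  have "open ?W" using finJ J open_U by (intro open_INT) auto
  moreover have "x \<in> ?W" using ab by (auto simp: B_def)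
  moreover have "x \<in> closure (U a \<inter> U b)"
    using E_Int_subset_closure[of a b] meet ab J x[of a] x[of b] by blast
  ultimately have "?W \<inter> (U a \<inter> U b) \<noteq> {}"
    using open_Int_closure_eq_empty[of ?W "U a \<inter> U b"] by blast
  moreover have "?W \<inter> (U a \<inter> U b) \<subseteq> (\<Inter>i\<in>J. U i)" by blast
  ultimately show ?thesis by blast
qed

text \<open>If \<open>U x\<close> and \<open>U y\<close> were disjoint, Janiszewski would make the
  intersection of \<open>E x \<union> K\<close> and \<open>E y \<union> E v\<close> connected, where
  \<open>K\<close> is the union of the closed discs of \<open>C\<close>. Up to finitely many
  touching points it consists of \<open>E x \<inter> E v\<close> and \<open>K \<inter> E y\<close>,
  so these meet. A common point lies on the curves of \<open>v\<close> and of some member of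
  \<open>C\<close>, hence on no third curve, hence in both \<open>U x\<close> and
  \<open>U y\<close>.\<close>

lemma separators_adjacent: "separators_adjacent (\<lambda>x y. U x \<inter> U y \<noteq> {}) I"
  unfolding separators_adjacent_def
proof (intro ballI allI impI notI)
  fix v C a x y
  assume "v \<in> I" "C \<subseteq> I" "a \<in> C" "x \<in> I" "y \<in> I"
    and *: "(\<forall>w\<in>C. (\<lambda>x y. U x \<inter> U y \<noteq> {} \<and> y \<in> C)\<^sup>*\<^sup>* a w \<and> \<not> U v \<inter> U w \<noteq> {}) \<and>
      U v \<inter> U x \<noteq> {} \<and> U v \<inter> U y \<noteq> {} \<and> (\<exists>w\<in>C. U x \<inter> U w \<noteq> {}) \<and> (\<exists>w\<in>C. U y \<inter> U w \<noteq> {})"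
    and disj: "U x \<inter> U y = {}"
  note assms = \<open>v \<in> I\<close> \<open>C \<subseteq> I\<close> \<open>a \<in> C\<close>
  have C: "(\<lambda>x y. U x \<inter> U y \<noteq> {} \<and> y \<in> C)\<^sup>*\<^sup>* a w" and vC: "U v \<inter> U w = {}" if "w \<in> C" for w
    using * that by blast+
  have xy: "x \<in> I" "y \<in> I" "U v \<inter> U x \<noteq> {}" "U v \<inter> U y \<noteq> {}"
      "\<exists>w\<in>C. U x \<inter> U w \<noteq> {}" "\<exists>w\<in>C. U y \<inter> U w \<noteq> {}"
    using * \<open>x \<in> I\<close> \<open>y \<in> I\<close> by blast+
  have "x \<noteq> y" using disj xy U_nonempty by auto
  have "v \<notin> C" using vC[of v] U_nonempty[OF assms(1)] by auto
  have "x \<noteq> v" "y \<noteq> v" using vC xy by auto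
  have "x \<notin> C" "y \<notin> C" using vC xy by auto
  define K where "K = (\<Union>i\<in>C. E i)"
  have finC: "finite C" using assms(2) finite_I finite_subset by blast
  have cK: "compact K" unfolding K_def
    using finC assms(2) compact_E by (intro compact_UN) auto
  have KE: "E i \<subseteq> K" if "i \<in> C" for i using that by (auto simp: K_def)
  \<comment> \<open>Along a chain of overlapping discs that starts with \<open>a\<close>, all points
    stay in the component of \<open>z\<close>.\<close>
  have connK: "connected K"
  proof -
    obtain z where z: "z \<in> U a" using U_nonempty assms by blast
    have comp: "connected_component K z t" if "w \<in> C" "t \<in> E w" for w t
    proof -
      have "\<forall>t\<in>E w. connected_component K z t"
        using C[OF \<open>w \<in> C\<close>]
      proof (induction rule: rtranclp_induct)
        case base
        then show ?case
          unfolding connected_component_def using z KE[of a] connected_E[of a] assms U_subset_E[of a]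
          by blast
      next
        case (step w w')
        then obtain s where s: "s \<in> U w" "s \<in> U w'" by blast
        then have "connected_component K z s"
          using step U_subset_E by blast
        moreover have "connected_component K s t" if "t \<in> E w'" for t
          unfolding connected_component_def
          using s that KE[of w'] step connected_E[of w'] assms U_subset_E[of w'] by blast
        ultimately show ?case by (blast intro: connected_component_trans)
      qed
      then show ?thesis using that by blast
    qed
    show ?thesis
      unfolding connected_iff_connected_component
    proof (intro ballI)
      fix s t
      assume "s \<in> K" "t \<in> K"
      then have "connected_component K z s" "connected_component K z t"
        using comp by (auto simp: K_def)
      then show "connected_component K s t"
        by (blast intro: connected_component_trans connected_component_sym)
    qed
  qed
  have meetK: "E s \<inter> K \<noteq> {}" if s: "\<exists>w\<in>C. U s \<inter> U w \<noteq> {}" for s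
  proof -
    obtain w where "w \<in> C" "U s \<inter> U w \<noteq> {}" using s by blast
    then show ?thesis using E_Int_nonempty[of s w] KE[of w] by blast
  qed
  have conn: "connected ((E x \<union> K) \<inter> (E y \<union> E v))"
  proof (rule Janiszewski_dual)
    show "compact (E x \<union> K)" "compact (E y \<union> E v)"
      using xy assms cK compact_E by auto
    then show "connected (E x \<union> K)"
      using connK connected_E xy meetK[OF xy(5)] by (intro connected_Un) auto
    have "E y \<inter> E v \<noteq> {}" using E_Int_nonempty[OF xy(4)] by blast
    then show "connected (E y \<union> E v)"
      using connected_E xy assms by (intro connected_Un) auto
    have "connected (- (\<Union>k\<in>{x, y, v} \<union> C. E k))"
      using xy assms by (intro connected_compl) auto
    moreover have "(\<Union>k\<in>{x, y, v} \<union> C. E k) = E x \<union> K \<union> (E y \<union> E v)"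
      by (auto simp: K_def)
    ultimately show "connected (- (E x \<union> K \<union> (E y \<union> E v)))" by (simp only:)
  qed
  have "closed (K \<inter> E y)" using cK by (intro closed_Int compact_imp_closed closed_closure)
  moreover have "finite (E x \<inter> E y \<union> (\<Union>i\<in>C. E i \<inter> E v))"
  proof -
    have "finite (E x \<inter> E y)"
      using disjoint_E_Int[OF _ _ disj] finite_S \<open>x \<noteq> y\<close> xy finite_subset by blast
    moreover have "finite (E i \<inter> E v)" if "i \<in> C" for i
    proof -
      have "E v \<inter> E i \<subseteq> S v \<inter> S i" "finite (S v \<inter> S i)"
        using disjoint_E_Int[of v i] vC[OF that] finite_S[of v i] assms \<open>v \<notin> C\<close> that by blast+
      then show ?thesis by (metis Int_commute finite_subset)
    qed
    ultimately show ?thesis using finC by blast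
  qed
  moreover have "(E x \<union> K) \<inter> (E y \<union> E v)
      = (E x \<inter> E v) \<union> (K \<inter> E y) \<union> (E x \<inter> E y \<union> (\<Union>i\<in>C. E i \<inter> E v))"
  proof -
    have "K \<inter> E v = (\<Union>i\<in>C. E i \<inter> E v)" by (simp add: K_def)
    then show ?thesis by (simp only: Int_Un_distrib Int_Un_distrib2 Un_ac)
  qed
  moreover have "E x \<inter> E v \<noteq> {}" "K \<inter> E y \<noteq> {}"
    using E_Int_nonempty[OF xy(3)] meetK[OF xy(6)] by (simp_all add: Int_commute)
  moreover have "closed (E x \<inter> E v)" by (intro closed_Int closed_closure)
  ultimately have "(E x \<inter> E v) \<inter> (K \<inter> E y) \<noteq> {}"
    by (metis connected_closed_parts_upto_finite[OF conn])
  then obtain z where "z \<in> (E x \<inter> E v) \<inter> (K \<inter> E y)" by (metis ex_in_conv)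
  then obtain i where z: "z \<in> E x" "z \<in> E v" "z \<in> E y" "z \<in> E i" "i \<in> C"
    unfolding K_def by blast
  have "E v \<inter> E i \<subseteq> S v \<inter> S i"
    using z assms by (intro disjoint_E_Int vC) auto
  then have zS: "z \<in> S v \<inter> S i"
    using z by blast
  have "z \<in> U w" if "w \<in> {x, y}" for w
  proof -
    have "S v \<inter> S i \<inter> S w = {}"
    proof (rule triple_S)
      show "v \<noteq> i" "v \<noteq> w" "i \<noteq> w"
        using that z(5) \<open>x \<noteq> v\<close> \<open>y \<noteq> v\<close> \<open>v \<notin> C\<close> \<open>x \<notin> C\<close> \<open>y \<notin> C\<close> by auto
    qed (use that z(5) assms xy(1,2) in auto)
    moreover have "z \<in> E w" "w \<in> I" using that z xy(1,2) by auto
    ultimately show ?thesis using zS closure_U[of w] by blast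
  qed
  then have "z \<in> U x \<inter> U y" by simp
  then show False using disj by blast
qed

text \<open>The neighbours of a simplicial disc, itself among them, meet pairwise, so
  \<open>Helly\<close> applies. If all discs of \<open>J\<close> meet each other, each of them is
  simplicial.\<close>

theorem common_point_of_neighbours:
  assumes "J \<subseteq> I" "J \<noteq> {}"
  shows "\<exists>i\<in>J. \<exists>z\<in>U i. \<forall>j\<in>J. U i \<inter> U j \<noteq> {} \<longrightarrow> z \<in> U j"
proof -
  let ?r = "\<lambda>x y. U x \<inter> U y \<noteq> {}"
  have "\<exists>i\<in>J. \<forall>x\<in>J. \<forall>y\<in>J. ?r i x \<longrightarrow> ?r i y \<longrightarrow> ?r x y"
  proof (cases "\<exists>v\<in>J. \<exists>u\<in>J. \<not> ?r v u")
    case True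
    then obtain v u where vu: "v \<in> J" "u \<in> J" "\<not> ?r v u" by blast
    have "\<exists>w\<in>J. \<not> ?r v w \<and> (\<forall>x\<in>J. \<forall>y\<in>J. ?r w x \<longrightarrow> ?r w y \<longrightarrow> ?r x y)"
    proof (rule simplicial_vertex_away[where r = ?r, OF _ _ _ _ vu])
      show "finite J" using assms finite_I finite_subset by blast
      show "symp ?r" by (auto intro!: sympI)
      show "reflp_on J ?r" using assms U_nonempty by (auto intro!: reflp_onI)
      show "separators_adjacent ?r J"
        by (rule separators_adjacent_subset[OF separators_adjacent assms(1)])
    qed
    then show ?thesis by blast
  next
    case False
    then show ?thesis using assms by blast
  qed
  then obtain i where i: "i \<in> J" "\<And>x y. x \<in> J \<Longrightarrow> y \<in> J \<Longrightarrow> ?r i x \<Longrightarrow> ?r i y \<Longrightarrow> ?r x y"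
    by blast
  have "?r i i" using i assms U_nonempty by auto
  have "(\<Inter>j\<in>{j \<in> J. ?r i j}. U j) \<noteq> {}"
    using i assms \<open>?r i i\<close> by (intro Helly) auto
  then obtain z where z: "\<And>j. j \<in> J \<Longrightarrow> ?r i j \<Longrightarrow> z \<in> U j" by auto
  show ?thesis
  proof (intro bexI ballI impI)
    show "i \<in> J" by (rule i(1))
    show "z \<in> U i" by (rule z[OF i(1) \<open>?r i i\<close>])
  qed (rule z)
qed

end


section \<open>Far sides of the curves of an arrangement\<close>

lemma Jordan_curveD:
  assumes "Jordan_curve S"
  shows "compact S" "open (inside S)" "open (outside S)" "connected (inside S)"
    "connected (outside S)" "inside S \<noteq> {}" "outside S \<noteq> {}" "bounded (inside S)"
    "\<not> bounded (outside S)" "\<And>x. x \<in> inside S \<Longrightarrow> x \<notin> S" "\<And>x. x \<in> outside S \<longleftrightarrow> x \<notin> inside S \<and> x \<notin> S"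
    "frontier (inside S) = S" "frontier (outside S) = S"
proof -
  obtain g where g: "simple_path g" "pathfinish g = pathstart g" "path_image g = S"
    using assms by (auto simp: Jordan_curve_def)
  show "compact S" using g(1,3) compact_simple_path_image by blast
  show "open (inside S)" "open (outside S)" "connected (inside S)"
    "connected (outside S)" "inside S \<noteq> {}" "outside S \<noteq> {}" "bounded (inside S)"
    "\<not> bounded (outside S)" "frontier (inside S) = S" "frontier (outside S) = S"
    using Jordan_inside_outside[OF g(1,2)] unfolding g(3) by simp_all
  show "x \<in> inside S \<Longrightarrow> x \<notin> S" for x
    using inside_no_overlap[of S] by blast
  show "x \<in> outside S \<longleftrightarrow> x \<notin> inside S \<and> x \<notin> S" for x
    by (auto simp: outside_inside)
qed

section \<open>Inversion of plane sets\<close>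

text \<open>
  The image of \<open>X\<close> under the inversion of the Riemann sphere that moves \<open>p\<close> to infinity, where
  \<open>X\<close> contains infinity iff it is unbounded.
\<close>

definition invert :: "complex \<Rightarrow> complex set \<Rightarrow> complex set" where
  "invert p X = {w. if w = 0 then \<not> bounded X else p + inverse w \<in> X}"

text \<open>If both \<open>X\<close> and its complement were unbounded, both would count as
  containing infinity.\<close>

lemma invert_Compl:
  assumes "bounded X \<or> bounded (- X)"
  shows "invert p (- X) = - invert p X"
proof -
  have "\<not> (bounded X \<and> bounded (- X))"
    using bounded_Un[of X "- X"] not_bounded_UNIV[where 'a = complex] by auto
  then show ?thesis using assms by (auto simp: invert_def)
qed

lemma invert_image: "x \<in> X \<Longrightarrow> x \<noteq> p \<Longrightarrow> inverse (x - p) \<in> invert p X"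
  by (simp add: invert_def)

lemma invert_minus_0: "invert p X - {0} = (\<lambda>x. inverse (x - p)) ` (X - {p})"
proof (intro equalityI subsetI)
  fix w assume "w \<in> invert p X - {0}"
  then have "w = inverse ((p + inverse w) - p)" "p + inverse w \<in> X - {p}"
    by (auto simp: invert_def)
  then show "w \<in> (\<lambda>x. inverse (x - p)) ` (X - {p})" by (rule image_eqI)
qed (auto simp: invert_def)

text \<open>Away from \<open>0\<close> this is continuity of the inverse. If \<open>0\<close>
  belongs to the image, then \<open>X\<close> has bounded complement and so contains a neighbourhood
  of infinity.\<close>

lemma open_invert:
  assumes "open X" "bounded X \<or> bounded (- X)"
  shows "open (invert p X)"
proof -
  have "continuous_on (- {0}) (\<lambda>w. p + inverse w)"
    by (intro continuous_intros) auto
  then have "open (- {0} \<inter> (\<lambda>w. p + inverse w) -` X)"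
    using assms(1) by (intro continuous_open_preimage) auto
  moreover have "- {0} \<inter> (\<lambda>w. p + inverse w) -` X = invert p X - {0}"
    by (auto simp: invert_def)
  ultimately have op: "open (invert p X - {0})" by simp
  show ?thesis
  proof (cases "bounded X")
    case True
    then have "invert p X - {0} = invert p X" by (auto simp: invert_def)
    then show ?thesis using op by simp
  next
    case False
    then obtain B where B: "B > 0" "\<And>z. z \<notin> X \<Longrightarrow> norm z \<le> B"
      using assms(2) by (auto simp: bounded_pos)
    define e where "e = inverse (B + norm p)"
    have "e > 0" using B(1) by (auto simp: e_def intro: add_pos_nonneg)
    have "ball (0::complex) e \<subseteq> invert p X"
    proof
      fix w :: complex assume w: "w \<in> ball 0 e"
      have "p + inverse w \<in> X" if "w \<noteq> 0"
      proof (rule ccontr)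
        assume "p + inverse w \<notin> X"
        then have "norm (p + inverse w) \<le> B" by (rule B(2))
        then have "norm (inverse w) \<le> B + norm p"
          using norm_triangle_ineq4[of "p + inverse w" p] by simp
        moreover have "inverse (norm w) > B + norm p"
          using w that \<open>e > 0\<close> less_imp_inverse_less[of "norm w" e] by (simp add: e_def)
        ultimately show False by (simp add: norm_inverse)
      qed
      then show "w \<in> invert p X" using False by (auto simp: invert_def)
    qed
    then have "invert p X = (invert p X - {0}) \<union> ball 0 e"
      using \<open>e > 0\<close> by auto
    then show ?thesis using op by (metis open_Un open_ball)
  qed
qed

lemma bounded_invert:
  assumes "p \<notin> closure X"
  shows "bounded (invert p X)"
proof -
  obtain e where "e > 0" and "\<not> (\<exists>x\<in>X. dist x p < e)"
    using assms unfolding closure_approachable by blast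
  then have e: "e \<le> dist x p" if "x \<in> X" for x using that by force
  have "norm w \<le> inverse e" if "w \<in> invert p X" for w
  proof (cases "w = 0")
    case False
    then have "e \<le> norm (inverse w)"
      using that e[of "p + inverse w"] by (simp add: invert_def dist_norm)
    then show ?thesis
      using \<open>e > 0\<close> le_imp_inverse_le[of e "norm (inverse w)"] by (simp add: norm_inverse)
  qed (use \<open>e > 0\<close> in simp)
  then show ?thesis by (rule boundedI)
qed

text \<open>Deleting \<open>p\<close> from a connected open plane set leaves it connected, so only
  \<open>0\<close> needs care: in an open set it is a limit of other points.\<close>

lemma connected_invert:
  assumes "open X" "connected X" "bounded X \<or> bounded (- X)"
  shows "connected (invert p X)"
proof -
  have "connected (X - {p})"
    using assms(1,2) by (intro connected_open_delete) simp_all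
  then have conn: "connected (invert p X - {0})"
    unfolding invert_minus_0
    by (intro connected_continuous_image continuous_intros) auto
  show ?thesis
  proof (cases "0 \<in> invert p X")
    case True
    then have "0 \<in> interior (invert p X)"
      using open_invert[OF assms(1,3), of p] by (simp add: interior_open)
    then have "0 \<in> closure (invert p X - {0})"
      using interior_limit_point islimpt_in_closure by blast
    then show ?thesis
      using closure_subset[of "invert p X - {0}"]
      by (intro connected_intermediate_closure[OF conn]) auto
  next
    case False
    then show ?thesis using conn by simp
  qed
qed

definition open_far :: "complex \<Rightarrow> complex set \<Rightarrow> complex set" where
  "open_far p S = (if p \<in> inside S then outside S else inside S)"

text \<open>For \<open>p\<close> off the curve this is the complement of
  \<open>far_side S p\<close>, so non-separation says that intersections of near sides are
  connected.\<close>

definition open_near :: "complex \<Rightarrow> complex set \<Rightarrow> complex set" where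
  "open_near p S = (if p \<in> inside S then inside S else outside S)"

context
  fixes S :: "complex set" and p :: complex
  assumes S: "Jordan_curve S" and pS: "p \<notin> S"
begin

lemma side_facts:
  shows "p \<in> open_near p S" "open (open_near p S)" "open (open_far p S)" "connected (open_far p S)"
    "open_far p S \<noteq> {}" "closure (open_far p S) = open_far p S \<union> S"
    "- closure (open_far p S) = open_near p S" "open_near p S \<inter> open_far p S = {}"
    "bounded (open_far p S) \<or> bounded (- open_far p S)"
    "bounded (open_near p S) \<or> bounded (- open_near p S)"
proof -
  note J = Jordan_curveD[OF S]
  show "p \<in> open_near p S" using pS by (simp add: open_near_def J(11))
  show "open (open_near p S)" "open (open_far p S)" "connected (open_far p S)" "open_far p S \<noteq> {}"
    using J(2-7) by (auto simp: open_near_def open_far_def)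
  have *: "closure (inside S) = inside S \<union> S" "closure (outside S) = outside S \<union> S"
    using closure_Un_frontier[of "inside S"] closure_Un_frontier[of "outside S"] J(12,13) by auto
  then show cl: "closure (open_far p S) = open_far p S \<union> S" by (auto simp: open_far_def)
  show "- closure (open_far p S) = open_near p S"
    unfolding cl using J(10) by (auto simp: open_far_def open_near_def J(11))
  show "open_near p S \<inter> open_far p S = {}"
    by (auto simp: open_far_def open_near_def J(11))
  have "- outside S = inside S \<union> S" by (auto simp: J(11))
  then have "bounded (- outside S)" using J(1,8) compact_imp_bounded by auto
  then show "bounded (open_far p S) \<or> bounded (- open_far p S)"
    "bounded (open_near p S) \<or> bounded (- open_near p S)"
    using J(8,9) by (auto simp: open_far_def open_near_def)
qed

lemma invert_S: "invert p S = (\<lambda>x. inverse (x - p)) ` S"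
proof -
  have "bounded S" using Jordan_curveD(1)[OF S] by (rule compact_imp_bounded)
  then have "invert p S - {0} = invert p S" by (auto simp: invert_def)
  then show ?thesis using invert_minus_0[of p S] pS by simp
qed

text \<open>The right side is the complement of an inverted near side, thus closed. Conversely,
  points of \<open>S\<close> are limits of far points, and the inversion is continuous there because
  \<open>p\<close> is not on \<open>S\<close>.\<close>

lemma closure_invert_far: "closure (invert p (open_far p S)) = invert p (open_far p S) \<union> invert p S"
proof
  have "- open_near p S = open_far p S \<union> S" using side_facts(6,7) by (metis double_complement)
  then have "- invert p (open_near p S) = invert p (open_far p S \<union> S)"
    using invert_Compl[OF side_facts(10)] by simp
  also have "\<dots> = invert p (open_far p S) \<union> invert p S"
    using compact_imp_bounded[OF Jordan_curveD(1)[OF S]] by (auto simp: invert_def)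
  finally have "closed (invert p (open_far p S) \<union> invert p S)"
    using open_invert[OF side_facts(2,10), of p] by (metis closed_open double_complement)
  then show "closure (invert p (open_far p S)) \<subseteq> invert p (open_far p S) \<union> invert p S"
    by (intro closure_minimal) auto
  have "invert p S \<subseteq> closure (invert p (open_far p S))"
  proof
    fix w assume "w \<in> invert p S"
    then obtain x where x: "x \<in> S" "w = inverse (x - p)" by (auto simp: invert_S)
    then have "x \<in> closure (open_far p S)" using side_facts(6) by auto
    then obtain f where f: "\<And>n. f n \<in> open_far p S" "f \<longlonglongrightarrow> x"
      unfolding closure_sequential by blast
    have "x - p \<noteq> 0" using x pS by auto
    then have "(\<lambda>n. inverse (f n - p)) \<longlonglongrightarrow> w"
      unfolding x(2) using f(2) by (intro tendsto_intros)
    moreover have "inverse (f n - p) \<in> invert p (open_far p S)" for n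
      using f(1)[of n] side_facts(1,8) by (intro invert_image) auto
    ultimately show "w \<in> closure (invert p (open_far p S))"
      unfolding closure_sequential by (intro exI[of _ "\<lambda>n. inverse (f n - p)"]) simp
  qed
  then show "invert p (open_far p S) \<union> invert p S \<subseteq> closure (invert p (open_far p S))"
    using closure_subset by blast
qed

end

section \<open>The discs of an arrangement seen from a point off the curves\<close>

text \<open>Every point of a Jordan curve is a limit of points inside, and finite unions of closed
  sets keep an empty interior. Used to move points off the curves.\<close>

lemma arrangement_interior_empty:
  assumes "arrangement \<S>"
  shows "interior (\<Union>\<S>) = {}"
proof -
  have "finite \<S>" "\<forall>S\<in>\<S>. Jordan_curve S" using assms by (auto simp: arrangement_def)
  then show ?thesis
  proof (induction rule: finite_induct)
    case (insert S \<S>)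
    note J = Jordan_curveD[of S, OF insert.prems[THEN bspec, OF insertI1]]
    have "interior S \<inter> inside S = {}" using J(10) interior_subset[of S] by blast
    then have "interior S \<inter> closure (inside S) = {}"
      by (simp add: open_Int_closure_eq_empty)
    moreover have "S \<subseteq> closure (inside S)" using J(12) by (auto simp: frontier_def)
    ultimately have "interior S = {}" using interior_subset[of S] by blast
    moreover have "closed S" using J(1) by (rule compact_imp_closed)
    ultimately show ?case
      using insert interior_closed_Un_empty_interior[of S "\<Union>\<S>"] by simp
  qed simp
qed

lemma open_meets_complement:
  assumes "arrangement \<S>" "open W" "W \<noteq> {}"
  obtains z where "z \<in> W" "z \<notin> \<Union>\<S>"
  using assms arrangement_interior_empty interior_maximal[of W "\<Union>\<S>"] by blast

context
  fixes \<S> :: "complex set set" and p :: complex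
  assumes simple: "simple_arrangement \<S>" and nonsep: "non_separating \<S>" and p: "p \<notin> \<Union>\<S>"
begin

lemma is_arrangement: "arrangement \<S>"
  using simple by (simp add: simple_arrangement_def)

lemma curves: "S \<in> \<S> \<Longrightarrow> Jordan_curve S" "S \<in> \<S> \<Longrightarrow> p \<notin> S"
  using is_arrangement p by (auto simp: arrangement_def)

lemma finite_curves: "finite \<S>"
  using is_arrangement by (simp add: arrangement_def)

lemma connected_Inter_near:
  assumes "\<T> \<subseteq> \<S>"
  shows "connected (\<Inter>S\<in>\<T>. open_near p S)"
proof -
  have "connected (- (\<Union>S\<in>\<T>. far_side S p))"
    using nonsep p assms by (auto simp: non_separating_def)
  moreover have "- (\<Union>S\<in>\<T>. far_side S p) = (\<Inter>S\<in>\<T>. - far_side S p)" by blast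
  moreover have "- far_side S p = open_near p S" if "S \<in> \<T>" for S
  proof -
    have "S \<in> \<S>" using assms that by blast
    then have "- closure (open_far p S) = open_near p S"
      using side_facts(7) curves by blast
    then show ?thesis by (simp add: far_side_def open_far_def)
  qed
  ultimately show ?thesis by simp
qed

text \<open>Only at \<open>0\<close>, the image of infinity, could inversion fail to commute with
  the intersection. It does commute: finitely many unbounded near sides have bounded complements, so
  their intersection is unbounded as well.\<close>

lemma connected_Inter_invert_near:
  assumes \<T>: "\<T> \<subseteq> \<S>"
  shows "connected (\<Inter>S\<in>\<T>. invert p (open_near p S))"
proof -
  let ?W = "\<Inter>S\<in>\<T>. open_near p S"
  have J: "Jordan_curve S" "p \<notin> S" if "S \<in> \<T>" for S using curves assms that by auto
  have fin: "finite \<T>" using finite_curves assms finite_subset by blast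
  have cobdd: "bounded (- ?W)" if unb: "\<And>S. S \<in> \<T> \<Longrightarrow> \<not> bounded (open_near p S)"
  proof -
    have "bounded (\<Union>S\<in>\<T>. - open_near p S)"
      using fin side_facts(10)[OF J] unb by (intro bounded_UN) auto
    then show ?thesis by simp
  qed
  have bdd: "bounded ?W" if "S \<in> \<T>" "bounded (open_near p S)" for S
    using that by (meson INT_lower bounded_subset)
  have W: "bounded ?W \<or> bounded (- ?W)"
    using cobdd bdd by blast
  have iff: "bounded ?W \<longleftrightarrow> (\<exists>S\<in>\<T>. bounded (open_near p S))"
    using cobdd bdd bounded_Un[of ?W "- ?W"] not_bounded_UNIV[where 'a = complex]
    by (metis Compl_partition)
  have "open ?W" using fin side_facts(2)[OF J] by (intro open_INT) auto
  then have "connected (invert p ?W)"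
    using connected_Inter_near[OF \<T>] W by (rule connected_invert)
  moreover have "w \<in> invert p ?W \<longleftrightarrow> w \<in> (\<Inter>S\<in>\<T>. invert p (open_near p S))" for w
    using iff by (cases "w = 0") (simp_all add: invert_def)
  ultimately show ?thesis by (metis subsetI subset_antisym)
qed

lemma disc_family_invert: "disc_family \<S> (\<lambda>S. invert p (open_far p S)) (invert p)"
proof
  show "finite \<S>" by (rule finite_curves)
next
  fix S assume "S \<in> \<S>"
  then have S: "Jordan_curve S" "p \<notin> S" using curves by auto
  note f = side_facts[OF S]
  show "open (invert p (open_far p S))" using f(3,9) by (rule open_invert)
  have "p \<notin> closure (open_far p S)" using f(1,7) by auto
  then show "bounded (invert p (open_far p S))" by (rule bounded_invert)
  show "connected (invert p (open_far p S))" using f(3,4,9) by (rule connected_invert)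
  obtain x where "x \<in> open_far p S" using f(5) by blast
  then show "invert p (open_far p S) \<noteq> {}"
    using f(1,8) invert_image[of x "open_far p S" p] by blast
  show "closure (invert p (open_far p S)) = invert p (open_far p S) \<union> invert p S"
    by (rule closure_invert_far[OF S])
next
  fix S T assume ST: "S \<in> \<S>" "T \<in> \<S>" "S \<noteq> T"
  then have "finite (S \<inter> T)" using is_arrangement by (simp add: arrangement_def)
  moreover have "invert p S \<inter> invert p T \<subseteq> (\<lambda>x. inverse (x - p)) ` (S \<inter> T)"
    using invert_S curves ST(1,2) by auto
  ultimately show "finite (invert p S \<inter> invert p T)"
    using finite_surj by blast
next
  fix S T R assume STR: "S \<in> \<S>" "T \<in> \<S>" "R \<in> \<S>" "S \<noteq> T" "S \<noteq> R" "T \<noteq> R"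
  have "S \<inter> T \<inter> R = {}"
  proof (rule ccontr)
    assume "S \<inter> T \<inter> R \<noteq> {}"
    then obtain x where "{S, T, R} \<subseteq> {S \<in> \<S>. x \<in> S}" using STR by blast
    then have "card {S, T, R} \<le> card {S \<in> \<S>. x \<in> S}"
      using finite_curves by (intro card_mono) auto
    also have "\<dots> \<le> 2" using simple by (simp add: simple_arrangement_def)
    finally show False using STR by simp
  qed
  moreover have "invert p S \<inter> invert p T \<inter> invert p R \<subseteq> (\<lambda>x. inverse (x - p)) ` (S \<inter> T \<inter> R)"
    using invert_S curves STR(1-3) by auto
  ultimately show "invert p S \<inter> invert p T \<inter> invert p R = {}" by simp
next
  fix \<T> assume \<T>: "\<T> \<subseteq> \<S>"
  have "- closure (invert p (open_far p S)) = invert p (open_near p S)" if "S \<in> \<T>" for S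
  proof -
    have S: "Jordan_curve S" "p \<notin> S" using curves that \<T> by auto
    have "invert p (open_near p S) = - invert p (- open_near p S)"
      using invert_Compl[OF side_facts(10)[OF S]] by simp
    also have "- open_near p S = open_far p S \<union> S" using side_facts(6,7)[OF S] by (metis double_complement)
    also have "invert p (open_far p S \<union> S) = invert p (open_far p S) \<union> invert p S"
      using compact_imp_bounded[OF Jordan_curveD(1)[OF S(1)]] by (auto simp: invert_def)
    finally show ?thesis using closure_invert_far[OF S] by simp
  qed
  then show "connected (- (\<Union>S\<in>\<T>. closure (invert p (open_far p S))))"
    using connected_Inter_invert_near[OF \<T>] by simp
qed

lemma simplicial_curve:
  assumes J: "\<J> \<subseteq> \<S>" "\<J> \<noteq> {}"
  shows "\<exists>S\<in>\<J>. \<exists>z. z \<notin> \<Union>\<S> \<and> z \<in> open_far p S \<and>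
    (\<forall>T\<in>\<J>. open_far p S \<inter> open_far p T \<noteq> {} \<longrightarrow> z \<in> open_far p T)"
proof -
  interpret disc_family \<S> "\<lambda>S. invert p (open_far p S)" "invert p"
    by (rule disc_family_invert)
  have far: "open (open_far p S)" "p \<notin> open_far p S" "open_far p S \<noteq> {}" if "S \<in> \<J>" for S
  proof -
    have S: "Jordan_curve S" "p \<notin> S" using curves J(1) that by auto
    show "open (open_far p S)" "p \<notin> open_far p S" "open_far p S \<noteq> {}"
      using side_facts(1,3,5,8)[OF S] by auto
  qed
  obtain S w where S: "S \<in> \<J>" and w: "\<And>T. T \<in> \<J> \<Longrightarrow>
      invert p (open_far p S) \<inter> invert p (open_far p T) \<noteq> {} \<Longrightarrow> w \<in> invert p (open_far p T)"
    using common_point_of_neighbours[OF J] by blast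
  define \<N> where "\<N> = {T \<in> \<J>. open_far p S \<inter> open_far p T \<noteq> {}}"
  have N: "\<N> \<subseteq> \<J>" "S \<in> \<N>"
    using S far(3) by (auto simp: \<N>_def)
  have finite_N: "finite \<N>"
    using N(1) J(1) finite_curves by (meson finite_subset)
  have "w \<in> invert p (open_far p T)" if T: "T \<in> \<N>" for T
  proof (rule w)
    show "T \<in> \<J>" using T by (simp add: \<N>_def)
    obtain x where "x \<in> open_far p S" "x \<in> open_far p T" using T by (auto simp: \<N>_def)
    then show "invert p (open_far p S) \<inter> invert p (open_far p T) \<noteq> {}"
      using invert_image[of x _ p] far(2)[OF S] by blast
  qed
  then have "w \<in> (\<Inter>T\<in>\<N>. invert p (open_far p T))" by blast
  moreover have "open (\<Inter>T\<in>\<N>. invert p (open_far p T))"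
    using N(1) finite_N open_U J(1) by (intro open_INT) auto
  \<comment> \<open>The common point may be \<open>0\<close>, which stands for infinity; the common
    open set is infinite, so another point can be taken.\<close>
  ultimately have "w \<in> closure ((\<Inter>T\<in>\<N>. invert p (open_far p T)) - {w})"
    by (metis interior_limit_point interior_open islimpt_in_closure)
  then have "w islimpt (\<Inter>T\<in>\<N>. invert p (open_far p T))"
    by (simp add: islimpt_in_closure)
  then have "infinite (\<Inter>T\<in>\<N>. invert p (open_far p T))"
    using islimpt_finite by blast
  then obtain v where v: "v \<in> (\<Inter>T\<in>\<N>. invert p (open_far p T))" "v \<noteq> 0"
    by (metis finite.emptyI finite.insertI finite_subset insertCI subsetI)
  then have "p + inverse v \<in> (\<Inter>T\<in>\<N>. open_far p T)" by (auto simp: invert_def)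
  moreover have "open (\<Inter>T\<in>\<N>. open_far p T)"
    using N(1) finite_N far(1) by (intro open_INT) auto
  ultimately obtain z where z: "z \<in> (\<Inter>T\<in>\<N>. open_far p T)" "z \<notin> \<Union>\<S>"
    using open_meets_complement[OF is_arrangement] by (metis empty_iff)
  have "z \<in> open_far p S" using z(1) N(2) by blast
  moreover have "z \<in> open_far p T" if "T \<in> \<J>" "open_far p S \<inter> open_far p T \<noteq> {}" for T
    using z(1) that by (auto simp: \<N>_def)
  ultimately show ?thesis using S z(2) by (intro bexI[of _ S] exI[of _ z]) simp_all
qed

end

section \<open>From cells to the table\<close>

definition table :: "presentation \<Rightarrow> nat \<Rightarrow> nat \<Rightarrow> bool" where
  "table A d s \<longleftrightarrow> snd A ! d \<subseteq> inside (fst A ! s)"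

locale presented_arrangement =
  fixes Ss Cs :: "complex set list" and \<S> :: "complex set set"
  assumes arr: "arrangement \<S>" and pres: "presents (Ss, Cs) \<S>"
begin

lemma presented: "distinct Ss" "set Ss = \<S>" "distinct Cs" "set Cs = cells \<S>"
  using pres by (auto simp: presents_def)

lemma cell_of_point:
  assumes "z \<notin> \<Union>\<S>"
  obtains d where "d < length Cs" "z \<in> Cs ! d"
proof -
  have "z \<in> \<Union>(set Cs)" unfolding presented(4) cells_def using assms by simp
  then show thesis using that by (auto simp: in_set_conv_nth)
qed

text \<open>A cell is connected and avoids the curve, so one bit decides the side for all of its
  points.\<close>

lemma cell_side:
  assumes "d < length Cs" "s < length Ss" "z \<in> Cs ! d"
  shows "z \<in> inside (Ss ! s) \<longleftrightarrow> table (Ss, Cs) d s" "z \<in> outside (Ss ! s) \<longleftrightarrow> \<not> table (Ss, Cs) d s"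
proof -
  have C: "Cs ! d \<in> components (- \<Union>\<S>)" "Ss ! s \<in> \<S>"
    using nth_mem[OF assms(1)] nth_mem[OF assms(2)] unfolding presented cells_def .
  then have J: "Jordan_curve (Ss ! s)" using arr by (auto simp: arrangement_def)
  note J = Jordan_curveD[OF J]
  have "connected (Cs ! d)" using C(1) by (rule in_components_connected)
  moreover have "Cs ! d \<inter> Ss ! s = {}"
    using C(2) in_components_subset[OF C(1)] by blast
  then have sub: "Cs ! d \<subseteq> inside (Ss ! s) \<union> outside (Ss ! s)"
    using J(11) by blast
  ultimately have "inside (Ss ! s) \<inter> Cs ! d = {} \<or> outside (Ss ! s) \<inter> Cs ! d = {}"
    using J(2,3,11) connectedD[of "Cs ! d" "inside (Ss ! s)" "outside (Ss ! s)"] by blast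
  then show "z \<in> inside (Ss ! s) \<longleftrightarrow> table (Ss, Cs) d s" "z \<in> outside (Ss ! s) \<longleftrightarrow> \<not> table (Ss, Cs) d s"
    using sub assms(3) J(11) by (auto simp: table_def)
qed

lemma cell_nonempty: "d < length Cs \<Longrightarrow> Cs ! d \<noteq> {}"
  using in_components_nonempty[OF nth_mem[of d Cs, unfolded presented cells_def]] .

lemma cell_off_curves: "d < length Cs \<Longrightarrow> Cs ! d \<inter> \<Union>\<S> = {}"
  using in_components_subset[OF nth_mem[of d Cs, unfolded presented cells_def]] by blast

text \<open>\<open>q\<close> may lie on curves. The open sides that contain it intersect in an open
  neighbourhood, which has a point off all curves; the cell of that point keeps every side of
  \<open>q\<close>.\<close>

lemma ex_cell_with_sides:
  obtains d where "d < length Cs"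
    "\<And>s. s < length Ss \<Longrightarrow> q \<in> inside (Ss ! s) \<Longrightarrow> table (Ss, Cs) d s"
    "\<And>s. s < length Ss \<Longrightarrow> q \<in> outside (Ss ! s) \<Longrightarrow> \<not> table (Ss, Cs) d s"
proof -
  define W where "W = (\<Inter>S\<in>{S \<in> \<S>. q \<in> inside S}. inside S) \<inter> (\<Inter>S\<in>{S \<in> \<S>. q \<in> outside S}. outside S)"
  have J: "Jordan_curve S" if "S \<in> \<S>" for S using arr that by (auto simp: arrangement_def)
  have "finite \<S>" using arr by (simp add: arrangement_def)
  then have "open W" unfolding W_def
    using Jordan_curveD(2,3)[OF J] by (intro open_Int open_INT) auto
  moreover have "q \<in> W" by (auto simp: W_def)
  ultimately obtain z where z: "z \<in> W" "z \<notin> \<Union>\<S>"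
    using open_meets_complement[OF arr] by (metis empty_iff)
  obtain d where d: "d < length Cs" "z \<in> Cs ! d" using cell_of_point[OF z(2)] .
  have "table (Ss, Cs) d s" if "s < length Ss" "q \<in> inside (Ss ! s)" for s
    using cell_side(1)[OF d(1) that(1) d(2)] z(1) that presented(2) by (auto simp: W_def)
  moreover have "\<not> table (Ss, Cs) d s" if "s < length Ss" "q \<in> outside (Ss ! s)" for s
    using cell_side(2)[OF d(1) that(1) d(2)] z(1) that presented(2) by (auto simp: W_def)
  ultimately show thesis using that d(1) by blast
qed

text \<open>A cell in two far sides shows that they overlap, so the curve and the point of
  \<open>simplicial_curve\<close> yield a curve and a cell with the combinatorial property.\<close>

lemma table_simplicial:
  assumes "simple_arrangement \<S>" "non_separating \<S>" "p < length Cs" "J \<subseteq> {..<length Ss}" "J \<noteq> {}"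
  shows "\<exists>s\<in>J. \<exists>c<length Cs. table (Ss, Cs) c s \<noteq> table (Ss, Cs) p s \<and>
    (\<forall>t\<in>J. (\<exists>d<length Cs. table (Ss, Cs) d s \<noteq> table (Ss, Cs) p s \<and>
                            table (Ss, Cs) d t \<noteq> table (Ss, Cs) p t) \<longrightarrow>
            table (Ss, Cs) c t \<noteq> table (Ss, Cs) p t)"
proof -
  obtain x where x: "x \<in> Cs ! p" using cell_nonempty assms(3) by blast
  have far: "z \<in> open_far x (Ss ! s) \<longleftrightarrow> table (Ss, Cs) d s \<noteq> table (Ss, Cs) p s"
    if "s < length Ss" "d < length Cs" "z \<in> Cs ! d" for s d z
    using cell_side[OF that(2,1,3)] cell_side[OF assms(3) that(1) x] by (auto simp: open_far_def)
  have "\<exists>S\<in>(!) Ss ` J. \<exists>z. z \<notin> \<Union>\<S> \<and> z \<in> open_far x S \<and>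
    (\<forall>T\<in>(!) Ss ` J. open_far x S \<inter> open_far x T \<noteq> {} \<longrightarrow> z \<in> open_far x T)"
  proof (rule simplicial_curve[OF assms(1,2)])
    show "x \<notin> \<Union>\<S>" using cell_off_curves[OF assms(3)] x by blast
    show "(!) Ss ` J \<subseteq> \<S>" using assms(4) presented(2) by auto
    show "(!) Ss ` J \<noteq> {}" using assms(5) by simp
  qed
  then obtain s z where s: "s \<in> J" "z \<notin> \<Union>\<S>" "z \<in> open_far x (Ss ! s)"
    and z: "\<And>t. t \<in> J \<Longrightarrow> open_far x (Ss ! s) \<inter> open_far x (Ss ! t) \<noteq> {} \<Longrightarrow> z \<in> open_far x (Ss ! t)"
    by auto
  obtain c where c: "c < length Cs" "z \<in> Cs ! c" using cell_of_point[OF s(2)] .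
  have J: "t < length Ss" if "t \<in> J" for t using that assms(4) by auto
  have "table (Ss, Cs) c t \<noteq> table (Ss, Cs) p t"
    if t: "t \<in> J" and d: "d < length Cs" "table (Ss, Cs) d s \<noteq> table (Ss, Cs) p s"
      "table (Ss, Cs) d t \<noteq> table (Ss, Cs) p t" for t d
  proof -
    obtain y where y: "y \<in> Cs ! d" using cell_nonempty d(1) by blast
    have "y \<in> open_far x (Ss ! s) \<inter> open_far x (Ss ! t)"
      using far[OF J[OF s(1)] d(1) y] far[OF J[OF t] d(1) y] d by simp
    then have "z \<in> open_far x (Ss ! t)" using z[OF t] by blast
    then show ?thesis using far[OF J[OF t] c] by simp
  qed
  moreover have "table (Ss, Cs) c s \<noteq> table (Ss, Cs) p s"
    using far[OF J[OF s(1)] c] s(3) by simp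
  ultimately show ?thesis using s(1) c(1) by blast
qed

end


section \<open>Greedy hitting sets\<close>

text \<open>Curve \<open>s\<close> separates the cells \<open>c\<close> and \<open>p\<close>: seen
  from \<open>p\<close>, the cell \<open>c\<close> lies in the far side of \<open>s\<close>.\<close>

definition far :: "(nat \<Rightarrow> nat \<Rightarrow> bool) \<Rightarrow> nat \<Rightarrow> nat \<Rightarrow> nat \<Rightarrow> bool" where
  "far F p c s \<longleftrightarrow> F c s \<noteq> F p s"

definition share :: "(nat \<Rightarrow> nat \<Rightarrow> bool) \<Rightarrow> nat \<Rightarrow> nat \<Rightarrow> nat \<Rightarrow> nat \<Rightarrow> bool" where
  "share F m p s t \<longleftrightarrow> (\<exists>d<m. far F p d s \<and> far F p d t)"

definition covers_neighbours ::
  "(nat \<Rightarrow> nat \<Rightarrow> bool) \<Rightarrow> nat \<Rightarrow> nat \<Rightarrow> nat set \<Rightarrow> nat \<Rightarrow> nat \<Rightarrow> bool" where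
  "covers_neighbours F m p J s c \<longleftrightarrow>
     s \<in> J \<and> far F p c s \<and> (\<forall>t\<in>J. share F m p s t \<longrightarrow> far F p c t)"

text \<open>
  \<open>J\<close> is the set of curves whose far side is not yet hit by the cells \<open>js\<close>. The witness \<open>W\<close> of
  optimality consists of the curves for which the cells of \<open>js\<close> other than \<open>p\<close> were chosen.
\<close>

definition greedy_state ::
  "(nat \<Rightarrow> nat \<Rightarrow> bool) \<Rightarrow> nat \<Rightarrow> nat \<Rightarrow> nat \<Rightarrow> nat set \<Rightarrow> nat list \<Rightarrow> bool" where
  "greedy_state F m n p J js \<longleftrightarrow>
     p \<in> set js \<and> distinct js \<and> set js \<subseteq> {..<m} \<and> J \<subseteq> {..<n} \<and>
     (\<forall>s<n. s \<in> J \<longleftrightarrow> (\<forall>j\<in>set js. \<not> far F p j s)) \<and>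
     (\<exists>W\<subseteq>{..<n} - J. Suc (card W) = length js \<and>
        (\<forall>s\<in>W. \<forall>t\<in>W \<union> J. s \<noteq> t \<longrightarrow> \<not> share F m p s t))"

lemma greedy_state_init: "p < m \<Longrightarrow> greedy_state F m n p {..<n} [p]"
  unfolding greedy_state_def by (auto simp: far_def intro!: exI[of _ "{}"])

text \<open>\<open>s\<close> joins the witness. It shares no cell with \<open>W\<close> because it
  was in \<open>J\<close>, and none with the curves that remain because \<open>c\<close> hits its
  neighbours in \<open>J\<close>. The cell \<open>c\<close> is new since no earlier cell hits
  \<open>s\<close>.\<close>

lemma greedy_state_step:
  assumes st: "greedy_state F m n p J js" and cov: "covers_neighbours F m p J s c" and "c < m"
  shows "greedy_state F m n p {t \<in> J. \<not> far F p c t} (js @ [c])"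
proof -
  obtain W where W: "W \<subseteq> {..<n} - J" "Suc (card W) = length js"
    "\<And>s t. s \<in> W \<Longrightarrow> t \<in> W \<union> J \<Longrightarrow> s \<noteq> t \<Longrightarrow> \<not> share F m p s t"
    using st by (auto simp: greedy_state_def)
  have st': "p \<in> set js" "distinct js" "set js \<subseteq> {..<m}" "J \<subseteq> {..<n}"
    "\<And>s. s < n \<Longrightarrow> s \<in> J \<longleftrightarrow> (\<forall>j\<in>set js. \<not> far F p j s)"
    using st by (auto simp: greedy_state_def)
  have s: "s \<in> J" "far F p c s" "\<And>t. t \<in> J \<Longrightarrow> share F m p s t \<Longrightarrow> far F p c t"
    using cov by (auto simp: covers_neighbours_def)
  have "s < n" "s \<notin> W" using s(1) st'(4) W(1) by auto
  have "c \<notin> set js" using s(1,2) st'(5)[OF \<open>s < n\<close>] by auto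
  have sym: "share F m p t u \<longleftrightarrow> share F m p u t" for t u by (auto simp: share_def)
  have "finite W" using W(1) finite_subset by blast
  have "insert s W \<subseteq> {..<n} - {t \<in> J. \<not> far F p c t}"
    using W(1) s(2) \<open>s < n\<close> by auto
  moreover have "Suc (card (insert s W)) = length (js @ [c])"
    using W(2) \<open>finite W\<close> \<open>s \<notin> W\<close> by simp
  moreover have "\<not> share F m p u t"
    if u: "u \<in> insert s W" and t: "t \<in> insert s W \<union> {t \<in> J. \<not> far F p c t}" "u \<noteq> t" for u t
  proof (cases "u = s")
    case True
    show ?thesis
    proof (cases "t \<in> W")
      case True
      then show ?thesis using W(3)[of t s] s(1) \<open>u = s\<close> t(2) sym by auto
    next
      case False
      then show ?thesis using s(3)[of t] True t by auto
    qed
  next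
    case False
    then show ?thesis using W(3)[of u t] u t s(1) by auto
  qed
  ultimately have "\<exists>W\<subseteq>{..<n} - {t \<in> J. \<not> far F p c t}. Suc (card W) = length (js @ [c]) \<and>
        (\<forall>s\<in>W. \<forall>t\<in>W \<union> {t \<in> J. \<not> far F p c t}. s \<noteq> t \<longrightarrow> \<not> share F m p s t)"
    by (intro exI[of _ "insert s W"] conjI ballI impI)
  moreover have "\<forall>s<n. s \<in> {t \<in> J. \<not> far F p c t} \<longleftrightarrow> (\<forall>j\<in>set (js @ [c]). \<not> far F p j s)"
    using st'(5) by auto
  ultimately show ?thesis
    unfolding greedy_state_def using st'(1-4) \<open>c \<notin> set js\<close> \<open>c < m\<close>
    by (intro conjI) auto
qed

text \<open>The witness has at most \<open>n\<close> curves. The bound fixes the sentinel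
  \<open>n + 2\<close> in \<open>main_prog\<close> and the number of entries copied by
  \<open>save_prog\<close>.\<close>

lemma greedy_state_length:
  assumes "greedy_state F m n p J js"
  shows "length js \<le> Suc n"
proof -
  obtain W where "W \<subseteq> {..<n} - J" "Suc (card W) = length js"
    using assms by (auto simp: greedy_state_def)
  moreover from this have "card W \<le> card {..<n}" by (intro card_mono) auto
  ultimately show ?thesis by simp
qed

text \<open>A point in cell \<open>p\<close> hits no far side, and no point hits the far sides of two curves in \<open>W\<close>.\<close>

lemma greedy_state_optimal:
  assumes st: "greedy_state F m n p J js"
    and Q: "Q \<subseteq> {..<m}" "p \<in> Q" "\<And>s. s < n \<Longrightarrow> \<exists>i\<in>Q. \<exists>j\<in>Q. F i s \<noteq> F j s"
  shows "length js \<le> card Q"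
proof -
  obtain W where W: "W \<subseteq> {..<n} - J" "Suc (card W) = length js"
    "\<And>s t. s \<in> W \<Longrightarrow> t \<in> W \<union> J \<Longrightarrow> s \<noteq> t \<Longrightarrow> \<not> share F m p s t"
    using st by (auto simp: greedy_state_def)
  have finQ: "finite Q" using Q(1) finite_subset by blast
  have "\<forall>s\<in>W. \<exists>q\<in>Q. far F p q s"
  proof
    fix s assume "s \<in> W"
    then have "s < n" using W(1) by auto
    then obtain i j where "i \<in> Q" "j \<in> Q" "F i s \<noteq> F j s" using Q(3) by blast
    \<comment> \<open>Two different bits cannot both agree with \<open>F p s\<close>.\<close>
    then show "\<exists>q\<in>Q. far F p q s" unfolding far_def by blast
  qed
  then obtain f where f: "\<And>s. s \<in> W \<Longrightarrow> f s \<in> Q" "\<And>s. s \<in> W \<Longrightarrow> far F p (f s) s"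
    by metis
  have "f s \<noteq> p" if "s \<in> W" for s using f(2)[OF that] by (auto simp: far_def)
  then have sub: "f ` W \<subseteq> Q - {p}" using f(1) by auto
  have "inj_on f W"
  proof (rule inj_onI)
    fix s t assume "s \<in> W" "t \<in> W" "f s = f t"
    then have "share F m p s t"
      unfolding share_def using f[of s] f(2)[of t] Q(1) by (intro exI[of _ "f s"]) auto
    then show "s = t" using W(3) \<open>s \<in> W\<close> \<open>t \<in> W\<close> by blast
  qed
  then have "card W \<le> card (Q - {p})"
    using sub finQ by (intro card_inj_on_le) auto
  also have "\<dots> < card Q" using Q(2) finQ by (intro card_Diff1_less)
  finally show ?thesis using W(2) by simp
qed

lemma greedy_state_final:
  assumes "greedy_state F m n p {} js" "s < n"
  shows "\<exists>i\<in>set js. \<exists>j\<in>set js. F i s \<noteq> F j s"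
  using assms unfolding greedy_state_def far_def by blast


section \<open>The program\<close>

text \<open>Without general while loops every program halts, its effect is the function
  \<open>run\<close>, and a time bound can be read off its structure.\<close>

datatype fprog =
    FSkip
  | FWrite array_name expr expr
  | FSeq fprog fprog
  | FIf expr fprog fprog
  | FFor array_name nat fprog

text \<open>The bound of a loop is an entry of the input array.\<close>

primrec compile :: "fprog \<Rightarrow> program" where
  "compile FSkip = Skip"
| "compile (FWrite x e f) = Write x e f"
| "compile (FSeq c d) = Seq (compile c) (compile d)"
| "compile (FIf e c d) = Cond e (compile c) (compile d)"
| "compile (FFor x b c) =
     Seq (Write x (Const 0) (Const 0))
       (While (Sub (Read ''input'' (Const b)) (Read x (Const 0)))
         (Seq (compile c) (Write x (Const 0) (Add (Read x (Const 0)) (Const 1)))))"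

definition set_var :: "array_name \<Rightarrow> nat \<Rightarrow> memory \<Rightarrow> memory" where
  "set_var x v M = M(x := (M x)(0 := v))"

lemma set_var_simps [simp]:
  "set_var x v M x 0 = v" "set_var x v M x (Suc i) = M x (Suc i)" "y \<noteq> x \<Longrightarrow> set_var x v M y = M y"
  by (simp_all add: set_var_def)

primrec run :: "fprog \<Rightarrow> memory \<Rightarrow> memory" where
  "run FSkip M = M"
| "run (FWrite x e f) M = M(x := (M x)(expr_val e M := expr_val f M))"
| "run (FSeq c d) M = run d (run c M)"
| "run (FIf e c d) M = (if expr_val e M \<noteq> 0 then run c M else run d M)"
| "run (FFor x b c) M = fold (\<lambda>k M. set_var x (Suc k) (run c M)) [0..<M ''input'' b] (set_var x 0 M)"

primrec written :: "fprog \<Rightarrow> array_name set" where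
  "written FSkip = {}"
| "written (FWrite x e f) = {x}"
| "written (FSeq c d) = written c \<union> written d"
| "written (FIf e c d) = written c \<union> written d"
| "written (FFor x b c) = insert x (written c)"

text \<open>\<open>b \<le> 1\<close> restricts loop bounds to the numbers of cells and of curves,
  the first two words of the code. A body that spares the counter makes \<open>run\<close> agree
  with the compiled loop.\<close>

primrec wf_prog :: "fprog \<Rightarrow> bool" where
  "wf_prog FSkip = True"
| "wf_prog (FWrite x e f) = True"
| "wf_prog (FSeq c d) = (wf_prog c \<and> wf_prog d)"
| "wf_prog (FIf e c d) = (wf_prog c \<and> wf_prog d)"
| "wf_prog (FFor x b c) = (wf_prog c \<and> x \<notin> written c \<and> b \<le> 1)"

text \<open>The variable bounds all loop counts. A loop pays 2 for its initialisation and last test,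
  and 2 per round for test and increment. The sum over both branches stands in for a
  maximum.\<close>

primrec time_bound :: "fprog \<Rightarrow> nat poly" where
  "time_bound FSkip = 1"
| "time_bound (FWrite x e f) = 1"
| "time_bound (FSeq c d) = time_bound c + time_bound d"
| "time_bound (FIf e c d) = 1 + time_bound c + time_bound d"
| "time_bound (FFor x b c) = 2 + [:0, 1:] * (time_bound c + 2)"

lemma run_not_written: "y \<notin> written c \<Longrightarrow> run c M y = M y"
proof (induction c arbitrary: M)
  case (FFor x b c)
  have "fold (\<lambda>k M. set_var x (Suc k) (run c M)) ks M y = M y" for ks M
    using FFor by (induction ks arbitrary: M) auto
  then show ?case using FFor by simp
qed auto

text \<open>The array \<open>input\<close> is never written, so \<open>N\<close> bounds the loop
  counts at every stage.\<close>

lemma exec_compile: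
  assumes "wf_prog c" "''input'' \<notin> written c" "M ''input'' 0 \<le> N" "M ''input'' 1 \<le> N"
  shows "\<exists>t\<le>poly (time_bound c) N. exec (compile c) M t (run c M)"
  using assms
proof (induction c arbitrary: M)
  case FSkip
  then show ?case using exec.Skip by (auto intro!: exI[of _ 1])
next
  case (FWrite x e f)
  then show ?case using exec.Write[of x e f M] by (intro exI[of _ 1]) (simp add: fun_upd_def)
next
  case (FSeq c d)
  obtain t where t: "t \<le> poly (time_bound c) N" "exec (compile c) M t (run c M)"
    using FSeq by auto
  obtain u where u: "u \<le> poly (time_bound d) N" "exec (compile d) (run c M) u (run d (run c M))"
    using FSeq.IH(2)[of "run c M"] FSeq.prems run_not_written[of "''input''" c M] by auto
  show ?case using exec.Seq[OF t(2) u(2)] t(1) u(1) by (auto intro!: exI[of _ "t + u"])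
next
  case (FIf e c d)
  show ?case
  proof (cases "expr_val e M = 0")
    case True
    obtain u where u: "u \<le> poly (time_bound d) N" "exec (compile d) M u (run d M)"
      using FIf by auto
    then show ?thesis using exec.CondFalse[OF True u(2)] True by (auto intro!: exI[of _ "1 + u"])
  next
    case False
    obtain u where u: "u \<le> poly (time_bound c) N" "exec (compile c) M u (run c M)"
      using FIf by auto
    then show ?thesis using exec.CondTrue[OF False u(2)] False by (auto intro!: exI[of _ "1 + u"])
  qed
next
  case (FFor x b c)
  let ?w = "While (Sub (Read ''input'' (Const b)) (Read x (Const 0)))
         (Seq (compile c) (Write x (Const 0) (Add (Read x (Const 0)) (Const 1))))"
  let ?T = "poly (time_bound c) N"
  have x: "x \<noteq> ''input''" "x \<notin> written c" "''input'' \<notin> written c" using FFor.prems by auto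
  \<comment> \<open>\<open>i\<close> rounds remain and the counter stands at
    \<open>j\<close>.\<close>
  have loop: "\<exists>t\<le>i * (?T + 2) + 1.
      exec ?w M' t (fold (\<lambda>k M. set_var x (Suc k) (run c M)) [j..<M ''input'' b] M')"
    if "M' x 0 = j" "j + i = M ''input'' b" "M' ''input'' = M ''input''" for i j M'
    using that
  proof (induction i arbitrary: j M')
    case 0
    have "exec ?w M' 1 M'" using 0 by (intro exec.WhileFalse) simp
    then show ?case using 0 by (auto intro!: exI[of _ 1])
  next
    case (Suc i)
    let ?M1 = "run c M'" and ?M2 = "set_var x (Suc j) (run c M')"
    obtain t where t: "t \<le> ?T" "exec (compile c) M' t ?M1"
      using FFor.IH[of M'] FFor.prems Suc.prems by auto
    have M1: "?M1 x 0 = j" "?M1 ''input'' = M ''input''"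
      using Suc.prems x run_not_written by auto
    have "exec (Write x (Const 0) (Add (Read x (Const 0)) (Const 1))) ?M1 1 ?M2"
      using exec.Write[of x "Const 0" "Add (Read x (Const 0)) (Const 1)" ?M1] M1(1)
      by (simp add: set_var_def)
    then have body: "exec (Seq (compile c) (Write x (Const 0) (Add (Read x (Const 0)) (Const 1)))) M' (t + 1) ?M2"
      by (rule exec.Seq[OF t(2)])
    obtain u where u: "u \<le> i * (?T + 2) + 1"
      "exec ?w ?M2 u (fold (\<lambda>k M. set_var x (Suc k) (run c M)) [Suc j..<M ''input'' b] ?M2)"
      using Suc.IH[of ?M2 "Suc j"] Suc.prems M1 x by auto
    have "exec ?w M' (1 + (t + 1) + u)
      (fold (\<lambda>k M. set_var x (Suc k) (run c M)) [Suc j..<M ''input'' b] ?M2)"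
      using Suc.prems by (intro exec.WhileTrue[OF _ body u(2)]) simp
    moreover have "[j..<M ''input'' b] = j # [Suc j..<M ''input'' b]"
      using Suc.prems by (intro upt_conv_Cons) simp
    ultimately show ?case using t(1) u(1) by (auto intro!: exI[of _ "1 + (t + 1) + u"])
  qed
  have "set_var x 0 M ''input'' = M ''input''" using x by simp
  then obtain t where t: "t \<le> M ''input'' b * (?T + 2) + 1" "exec ?w (set_var x 0 M) t (run (FFor x b c) M)"
    using loop[of "set_var x 0 M" 0 "M ''input'' b"] by auto
  have "exec (Write x (Const 0) (Const 0)) M 1 (set_var x 0 M)"
    using exec.Write[of x "Const 0" "Const 0" M] by (simp add: set_var_def)
  then have "exec (compile (FFor x b c)) M (1 + t) (run (FFor x b c) M)"
    using exec.Seq t(2) unfolding compile.simps by blast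
  moreover have "M ''input'' b \<le> N" using FFor.prems by (cases b) auto
  then have "M ''input'' b * (?T + 2) \<le> N * (?T + 2)" by (rule mult_le_mono1)
  then have "1 + t \<le> poly (time_bound (FFor x b c)) N" using t(1) by (simp add: algebra_simps)
  ultimately show ?case by blast
qed

text \<open>\<open>stable\<close> makes the invariant ignore the counter, so each use treats the
  body only; the body may still rely on the value \<open>k\<close> of the counter.\<close>

lemma run_For_invariant:
  assumes "x \<notin> written c" "''input'' \<notin> insert x (written c)" and N: "M ''input'' b = N"
    and init: "I 0 M"
    and step: "\<And>k M'. k < N \<Longrightarrow> I k M' \<Longrightarrow> M' x 0 = k \<Longrightarrow> I (Suc k) (run c M')"
    and stable: "\<And>k v M'. I k M' \<Longrightarrow> I k (set_var x v M')"
  shows "I N (run (FFor x b c) M)"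
proof -
  let ?M = "\<lambda>k. fold (\<lambda>k M. set_var x (Suc k) (run c M)) [0..<k] (set_var x 0 M)"
  have "I k (?M k) \<and> ?M k x 0 = k" if "k \<le> N" for k
    using that
  proof (induction k)
    case 0
    then show ?case using stable init by simp
  next
    case (Suc k)
    then show ?case using step[of k "?M k"] stable by simp
  qed
  then show ?thesis using N by simp
qed

section \<open>The algorithm as a loop program\<close>

abbreviation V :: "array_name \<Rightarrow> expr" where
  "V x \<equiv> Read x (Const 0)"

text \<open>The machine cannot multiply, so the offset \<open>c * n\<close> is tabulated in
  \<open>row\<close> by repeated addition. The 2 skips the two sizes at the start of the
  input.\<close>

definition entry :: "expr \<Rightarrow> expr \<Rightarrow> expr" where
  "entry c s = Read ''input'' (Add (Read ''row'' c) (Add s (Const 2)))"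

text \<open>Truncated subtraction both ways gives the absolute difference, nonzero iff the bits
  differ.\<close>

definition far_expr :: "expr \<Rightarrow> expr \<Rightarrow> expr" where
  "far_expr c s = Add (Sub (entry c s) (entry (V ''p'') s)) (Sub (entry (V ''p'') s) (entry c s))"

definition rows_prog :: fprog where
  "rows_prog = FFor ''c'' 0
     (FWrite ''row'' (Add (V ''c'') (Const 1)) (Add (Read ''row'' (V ''c'')) (Read ''input'' (Const 1))))"

definition test_pair_prog :: fprog where
  "test_pair_prog = FFor ''d'' 0
     (FIf (far_expr (V ''d'') (V ''s''))
       (FIf (far_expr (V ''d'') (V ''t'')) (FWrite ''ok'' (Const 0) (Const 0)) FSkip) FSkip)"

text \<open>Leaves \<open>ok\<close> nonzero iff \<open>covers_neighbours\<close> holds for the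
  active curves: an active \<open>t\<close> not hit by \<open>c\<close> refutes it if
  \<open>test_pair_prog\<close> finds a cell in both far sides.\<close>

definition test_prog :: fprog where
  "test_prog = FSeq
     (FIf (Read ''act'' (V ''s''))
       (FIf (far_expr (V ''c'') (V ''s'')) (FWrite ''ok'' (Const 0) (Const 1)) (FWrite ''ok'' (Const 0) (Const 0)))
       (FWrite ''ok'' (Const 0) (Const 0)))
     (FFor ''t'' 1
       (FIf (Read ''act'' (V ''t''))
         (FIf (far_expr (V ''c'') (V ''t'')) FSkip test_pair_prog) FSkip))"

definition deactivate_prog :: fprog where
  "deactivate_prog = FFor ''t'' 1
     (FIf (far_expr (V ''c'') (V ''t'')) (FWrite ''act'' (V ''t'') (Const 0)) FSkip)"

text \<open>Entry 0 of \<open>sol\<close> is the length, as in the output format; once incremented,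
  it is the index at which \<open>c\<close> goes.\<close>

definition push_prog :: fprog where
  "push_prog = FIf (V ''ok'')
     (FSeq (FSeq (FWrite ''sol'' (Const 0) (Add (V ''sol'') (Const 1)))
                 (FWrite ''sol'' (V ''sol'') (V ''c'')))
       deactivate_prog)
     FSkip"

definition sweep_prog :: fprog where
  "sweep_prog = FFor ''s'' 1 (FFor ''c'' 0 (FSeq test_prog push_prog))"

definition init_prog :: fprog where
  "init_prog = FSeq
     (FSeq (FWrite ''sol'' (Const 0) (Const 1)) (FWrite ''sol'' (Const 1) (V ''p'')))
     (FFor ''s'' 1 (FWrite ''act'' (V ''s'') (Const 1)))"

text \<open>Only a strictly shorter list is saved. Entries 0 and 1 and \<open>n\<close> more give
  room for the length and up to \<open>n + 1\<close> cells.\<close>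

definition save_prog :: fprog where
  "save_prog = FIf (Sub (V ''output'') (V ''sol''))
     (FSeq (FSeq (FWrite ''output'' (Const 0) (V ''sol'')) (FWrite ''output'' (Const 1) (Read ''sol'' (Const 1))))
       (FFor ''i'' 1 (FWrite ''output'' (Add (V ''i'') (Const 2)) (Read ''sol'' (Add (V ''i'') (Const 2))))))
     FSkip"

definition candidate_prog :: fprog where
  "candidate_prog = FSeq (FSeq init_prog (FFor ''r'' 1 sweep_prog)) save_prog"

text \<open>The sentinel \<open>n + 2\<close> exceeds the length of every greedy list, so the first
  one is always saved. Without curves the empty set is optimal, and the initial zeros of
  \<open>output\<close> encode it.\<close>

definition main_prog :: fprog where
  "main_prog = FSeq rows_prog
     (FIf (Read ''input'' (Const 1))
       (FSeq (FWrite ''output'' (Const 0) (Add (Read ''input'' (Const 1)) (Const 2)))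
         (FFor ''p'' 0 candidate_prog))
       FSkip)"

lemmas prog_defs = rows_prog_def test_pair_prog_def test_prog_def deactivate_prog_def push_prog_def
  sweep_prog_def init_prog_def save_prog_def candidate_prog_def main_prog_def

lemma written_progs [simp]:
  "written rows_prog = {''c'', ''row''}"
  "written test_pair_prog = {''d'', ''ok''}"
  "written test_prog = {''ok'', ''t'', ''d''}"
  "written deactivate_prog = {''t'', ''act''}"
  "written push_prog = {''sol'', ''t'', ''act''}"
  "written sweep_prog = {''s'', ''c'', ''ok'', ''t'', ''d'', ''sol'', ''act''}"
  "written init_prog = {''sol'', ''s'', ''act''}"
  "written save_prog = {''output'', ''i''}"
  by (auto simp: prog_defs)

lemma wf_main_prog: "wf_prog main_prog" "''input'' \<notin> written main_prog"
  by (simp_all add: prog_defs)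

definition stored_list :: "memory \<Rightarrow> array_name \<Rightarrow> nat list" where
  "stored_list M x = map (\<lambda>i. M x (Suc i)) [0..<M x 0]"

lemma output_of_stored_list: "output_of M = stored_list M ''output''"
  by (simp add: output_of_def stored_list_def)

section \<open>Correctness of the loop program\<close>

context
  fixes m n :: nat and F :: "nat \<Rightarrow> nat \<Rightarrow> bool"
begin

definition input_ok :: "memory \<Rightarrow> bool" where
  "input_ok M \<longleftrightarrow> M ''input'' 0 = m \<and> M ''input'' (Suc 0) = n \<and>
     (\<forall>c<m. \<forall>s<n. M ''input'' (c * n + (s + 2)) = of_bool (F c s))"

definition tables_ok :: "nat \<Rightarrow> memory \<Rightarrow> bool" where
  "tables_ok p M \<longleftrightarrow> input_ok M \<and> (\<forall>c<m. M ''row'' c = c * n) \<and> M ''p'' 0 = p \<and> p < m"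

definition active :: "memory \<Rightarrow> nat set" where
  "active M = {s. s < n \<and> M ''act'' s \<noteq> 0}"

lemma tables_ok_cong:
  "M' ''input'' = M ''input'' \<Longrightarrow> M' ''row'' = M ''row'' \<Longrightarrow> M' ''p'' = M ''p'' \<Longrightarrow>
    tables_ok p M' = tables_ok p M"
  by (simp add: tables_ok_def input_ok_def)

lemma active_cong: "M' ''act'' = M ''act'' \<Longrightarrow> active M' = active M"
  by (simp add: active_def)

lemma stored_list_cong: "M' x = M x \<Longrightarrow> stored_list M' x = stored_list M x"
  by (simp add: stored_list_def)

lemma far_expr_val:
  assumes "tables_ok p M" "expr_val ce M < m" "expr_val se M < n"
  shows "expr_val (far_expr ce se) M \<noteq> 0 \<longleftrightarrow> far F p (expr_val ce M) (expr_val se M)"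
  using assms unfolding tables_ok_def input_ok_def far_def far_expr_def entry_def by auto

lemma run_rows_prog:
  assumes "input_ok M" "M ''row'' 0 = 0"
  shows "\<forall>c<m. run rows_prog M ''row'' c = c * n"
proof -
  let ?I = "\<lambda>k M'. M' ''input'' = M ''input'' \<and> (\<forall>c\<le>k. M' ''row'' c = c * n)"
  have "?I m (run rows_prog M)"
    unfolding rows_prog_def
  proof (rule run_For_invariant[where I = ?I])
    show "M ''input'' 0 = m" using assms by (simp add: input_ok_def)
  qed (use assms in \<open>auto simp: input_ok_def le_Suc_eq\<close>)
  then show ?thesis by simp
qed

lemma run_test_pair_prog:
  assumes M: "tables_ok p M" "M ''s'' 0 = s" "s < n" "M ''t'' 0 = t" "t < n"
  shows "run test_pair_prog M ''ok'' 0 \<noteq> 0 \<longleftrightarrow> M ''ok'' 0 \<noteq> 0 \<and> \<not> share F m p s t"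
proof -
  let ?I = "\<lambda>k M'. (\<forall>y. y \<notin> {''d'', ''ok''} \<longrightarrow> M' y = M y) \<and>
    (M' ''ok'' 0 \<noteq> 0 \<longleftrightarrow> M ''ok'' 0 \<noteq> 0 \<and> (\<forall>d<k. \<not> (far F p d s \<and> far F p d t)))"
  have "?I m (run test_pair_prog M)"
    unfolding test_pair_prog_def
  proof (rule run_For_invariant[where I = ?I])
    show "M ''input'' 0 = m" using M by (simp add: tables_ok_def input_ok_def)
    fix k M' assume k: "k < m" "?I k M'" "M' ''d'' 0 = k"
    then have "tables_ok p M'" using M(1) tables_ok_cong[of M' M] by simp
    then have "expr_val (far_expr (V ''d'') (V ''s'')) M' \<noteq> 0 \<longleftrightarrow> far F p k s"
      "expr_val (far_expr (V ''d'') (V ''t'')) M' \<noteq> 0 \<longleftrightarrow> far F p k t"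
      using far_expr_val[of p M' "V ''d''"] k M by simp_all
    then show "?I (Suc k) (run (FIf (far_expr (V ''d'') (V ''s''))
       (FIf (far_expr (V ''d'') (V ''t'')) (FWrite ''ok'' (Const 0) (Const 0)) FSkip) FSkip) M')"
      using k(2) by (auto simp: less_Suc_eq)
  qed auto
  then show ?thesis by (auto simp: share_def)
qed

lemma run_test_prog:
  assumes M: "tables_ok p M" "M ''s'' 0 = s" "s < n" "M ''c'' 0 = c" "c < m"
  shows "run test_prog M ''ok'' 0 \<noteq> 0 \<longleftrightarrow> covers_neighbours F m p (active M) s c"
proof -
  let ?c1 = "FIf (Read ''act'' (V ''s''))
       (FIf (far_expr (V ''c'') (V ''s'')) (FWrite ''ok'' (Const 0) (Const 1)) (FWrite ''ok'' (Const 0) (Const 0)))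
       (FWrite ''ok'' (Const 0) (Const 0))"
  let ?c2 = "FIf (Read ''act'' (V ''t''))
         (FIf (far_expr (V ''c'') (V ''t'')) FSkip test_pair_prog) FSkip"
  let ?M1 = "run ?c1 M"
  have M1: "?M1 y = M y" if "y \<noteq> ''ok''" for y
    using that by (intro run_not_written) simp
  have "expr_val (far_expr (V ''c'') (V ''s'')) M \<noteq> 0 \<longleftrightarrow> far F p c s"
    using far_expr_val[of p M "V ''c''"] M by simp
  then have ok1: "?M1 ''ok'' 0 \<noteq> 0 \<longleftrightarrow> s \<in> active M \<and> far F p c s"
    using M by (simp add: active_def)
  let ?I = "\<lambda>k M'. (\<forall>y. y \<notin> {''d'', ''ok'', ''t''} \<longrightarrow> M' y = M y) \<and>
    (M' ''ok'' 0 \<noteq> 0 \<longleftrightarrow> s \<in> active M \<and> far F p c s \<and>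
       (\<forall>t<k. t \<in> active M \<longrightarrow> share F m p s t \<longrightarrow> far F p c t))"
  have "?I n (run (FFor ''t'' 1 ?c2) ?M1)"
  proof (rule run_For_invariant[where I = ?I])
    show "?M1 ''input'' 1 = n" using M M1 by (simp add: tables_ok_def input_ok_def)
    show "?I 0 ?M1" using ok1 M1 by simp
    fix k M' assume k: "k < n" "?I k M'" "M' ''t'' 0 = k"
    have ok: "tables_ok p M'" using k(2) M(1) tables_ok_cong[of M' M] by simp
    have far: "expr_val (far_expr (V ''c'') (V ''t'')) M' \<noteq> 0 \<longleftrightarrow> far F p c k"
      using far_expr_val[OF ok, of "V ''c''"] k M by simp
    have pair: "run test_pair_prog M' ''ok'' 0 \<noteq> 0 \<longleftrightarrow> M' ''ok'' 0 \<noteq> 0 \<and> \<not> share F m p s k"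
      using run_test_pair_prog[OF ok _ M(3) k(3,1)] k(2) M(2) by simp
    have act: "M' ''act'' k \<noteq> 0 \<longleftrightarrow> k \<in> active M" using k by (simp add: active_def)
    have "\<forall>y. y \<notin> {''d'', ''ok'', ''t''} \<longrightarrow> run ?c2 M' y = M' y"
      by (intro allI impI run_not_written) auto
    moreover have "run ?c2 M' ''ok'' 0 \<noteq> 0 \<longleftrightarrow> M' ''ok'' 0 \<noteq> 0 \<and>
        (k \<in> active M \<longrightarrow> share F m p s k \<longrightarrow> far F p c k)"
      using act far pair k(3) by auto
    ultimately show "?I (Suc k) (run ?c2 M')"
      using k(2) by (auto simp: less_Suc_eq)
  qed auto
  then show ?thesis
    by (auto simp: test_prog_def covers_neighbours_def active_def)
qed

lemma run_deactivate_prog: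
  assumes M: "tables_ok p M" "M ''c'' 0 = c" "c < m"
  shows "active (run deactivate_prog M) = {t \<in> active M. \<not> far F p c t}"
proof -
  let ?c = "FIf (far_expr (V ''c'') (V ''t'')) (FWrite ''act'' (V ''t'') (Const 0)) FSkip"
  let ?I = "\<lambda>k M'. (\<forall>y. y \<notin> {''t'', ''act''} \<longrightarrow> M' y = M y) \<and>
    (\<forall>t<n. M' ''act'' t \<noteq> 0 \<longleftrightarrow> M ''act'' t \<noteq> 0 \<and> \<not> (t < k \<and> far F p c t))"
  have "?I n (run deactivate_prog M)"
    unfolding deactivate_prog_def
  proof (rule run_For_invariant[where I = ?I])
    show "M ''input'' 1 = n" using M by (simp add: tables_ok_def input_ok_def)
    fix k M' assume k: "k < n" "?I k M'" "M' ''t'' 0 = k"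
    have ok: "tables_ok p M'" using k(2) M(1) tables_ok_cong[of M' M] by simp
    have far: "expr_val (far_expr (V ''c'') (V ''t'')) M' \<noteq> 0 \<longleftrightarrow> far F p c k"
      using far_expr_val[OF ok, of "V ''c''"] k M by simp
    then show "?I (Suc k) (run ?c M')"
      using k by (auto simp: less_Suc_eq)
  qed auto
  then show ?thesis by (auto simp: active_def)
qed

lemma run_push_prog:
  assumes M: "tables_ok p M" "M ''c'' 0 = c" "c < m"
  shows "active (run push_prog M) = (if M ''ok'' 0 \<noteq> 0 then {t \<in> active M. \<not> far F p c t} else active M)"
    "stored_list (run push_prog M) ''sol'' =
       (if M ''ok'' 0 \<noteq> 0 then stored_list M ''sol'' @ [c] else stored_list M ''sol'')"
proof -
  let ?M1 = "run (FSeq (FWrite ''sol'' (Const 0) (Add (V ''sol'') (Const 1)))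
                 (FWrite ''sol'' (V ''sol'') (V ''c''))) M"
  have M1: "?M1 y = M y" if "y \<noteq> ''sol''" for y
    using that by (intro run_not_written) simp
  have ok: "tables_ok p ?M1" using M(1) tables_ok_cong[of ?M1 M] M1 by simp
  show "active (run push_prog M) = (if M ''ok'' 0 \<noteq> 0 then {t \<in> active M. \<not> far F p c t} else active M)"
    using run_deactivate_prog[OF ok, of c] M M1 active_cong[of ?M1 M] by (simp add: push_prog_def)
  have "stored_list (run push_prog M) ''sol'' = stored_list M ''sol'' @ [c]" if "M ''ok'' 0 \<noteq> 0"
  proof -
    have "run push_prog M ''sol'' = ?M1 ''sol''"
      using that run_not_written[of "''sol''" deactivate_prog ?M1] by (simp add: push_prog_def)
    moreover have "?M1 ''sol'' = (M ''sol'')(0 := Suc (M ''sol'' 0), Suc (M ''sol'' 0) := c)"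
      using M(2) by (simp add: fun_eq_iff)
    ultimately show ?thesis by (simp add: stored_list_def)
  qed
  then show "stored_list (run push_prog M) ''sol'' =
       (if M ''ok'' 0 \<noteq> 0 then stored_list M ''sol'' @ [c] else stored_list M ''sol'')"
    by (simp add: push_prog_def)
qed

definition greedy_memory :: "nat \<Rightarrow> memory \<Rightarrow> bool" where
  "greedy_memory p M \<longleftrightarrow> tables_ok p M \<and> greedy_state F m n p (active M) (stored_list M ''sol'')"

lemma greedy_memory_set_var:
  "x \<notin> {''input'', ''row'', ''p'', ''act'', ''sol''} \<Longrightarrow>
     greedy_memory p (set_var x v M) = greedy_memory p M \<and> active (set_var x v M) = active M"
  using tables_ok_cong[of "set_var x v M" M p] active_cong[of "set_var x v M" M]
    stored_list_cong[of "set_var x v M" "''sol''" M]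
  by (auto simp: greedy_memory_def)

lemma run_test_push:
  assumes M: "greedy_memory p M" "M ''s'' 0 = s" "s < n" "M ''c'' 0 = c" "c < m"
  defines "M' \<equiv> run (FSeq test_prog push_prog) M"
  shows "greedy_memory p M'" "active M' \<subseteq> active M"
    "covers_neighbours F m p (active M) s c \<Longrightarrow> s \<notin> active M'"
proof -
  let ?M1 = "run test_prog M"
  have ok: "tables_ok p M" using M(1) by (simp add: greedy_memory_def)
  have M1: "?M1 y = M y" if "y \<notin> {''ok'', ''t'', ''d''}" for y
    using that by (intro run_not_written) simp
  have ok1: "tables_ok p ?M1" using ok tables_ok_cong[of ?M1 M] M1 by simp
  have M': "M' y = ?M1 y" if "y \<notin> {''sol'', ''t'', ''act''}" for y
    unfolding M'_def using that by (simp add: run_not_written)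
  have act1: "active ?M1 = active M" "stored_list ?M1 ''sol'' = stored_list M ''sol''"
    using active_cong[of ?M1 M] stored_list_cong[of ?M1 "''sol''" M] M1 by simp_all
  note test = run_test_prog[OF ok M(2-5)]
  note push = run_push_prog[OF ok1 _ M(5)]
  have act: "active M' = (if covers_neighbours F m p (active M) s c
      then {t \<in> active M. \<not> far F p c t} else active M)"
    and sol: "stored_list M' ''sol'' = (if covers_neighbours F m p (active M) s c
      then stored_list M ''sol'' @ [c] else stored_list M ''sol'')"
    using push M1 M(4) test act1 by (simp_all add: M'_def)
  have "tables_ok p M'" using ok1 tables_ok_cong[of M' ?M1] M' by simp
  moreover have "greedy_state F m n p (active M') (stored_list M' ''sol'')"
    using M(1) greedy_state_step[OF _ _ M(5)] act sol by (auto simp: greedy_memory_def)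
  ultimately show "greedy_memory p M'" by (simp add: greedy_memory_def)
  show "active M' \<subseteq> active M" using act by auto
  show "s \<notin> active M'" if "covers_neighbours F m p (active M) s c"
    using act that by (auto simp: covers_neighbours_def)
qed

text \<open>Active curves only disappear during a sweep, so a pair that qualifies at its start still
  qualifies at its turn, unless its curve has been hit meanwhile.\<close>

lemma covers_neighbours_antimono:
  "covers_neighbours F m p J s c \<Longrightarrow> J' \<subseteq> J \<Longrightarrow> s \<in> J' \<Longrightarrow> covers_neighbours F m p J' s c"
  by (auto simp: covers_neighbours_def)

lemma run_sweep_prog:
  assumes M: "greedy_memory p M"
  shows "greedy_memory p (run sweep_prog M)" "active (run sweep_prog M) \<subseteq> active M"
    "\<And>s c. s < n \<Longrightarrow> c < m \<Longrightarrow> covers_neighbours F m p (active M) s c \<Longrightarrow> s \<notin> active (run sweep_prog M)"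
proof -
  let ?c = "FSeq test_prog push_prog"
  \<comment> \<open>Refers to the active curves at the start of the sweep, not to the current
    ones.\<close>
  let ?cov = "covers_neighbours F m p (active M)"
  let ?I = "\<lambda>k M'. greedy_memory p M' \<and> active M' \<subseteq> active M \<and>
    (\<forall>s<k. \<forall>c<m. ?cov s c \<longrightarrow> s \<notin> active M')"
  have "?I n (run sweep_prog M)"
    unfolding sweep_prog_def
  proof (rule run_For_invariant[where I = ?I])
    show "M ''input'' 1 = n" using M by (simp add: greedy_memory_def tables_ok_def input_ok_def)
    show "?I 0 M" using M by simp
    fix s M1 assume s: "s < n" "?I s M1" "M1 ''s'' 0 = s"
    let ?I' = "\<lambda>k M'. M' ''s'' 0 = s \<and> ?I s M' \<and> (\<forall>c<k. ?cov s c \<longrightarrow> s \<notin> active M')"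
    have "?I' m (run (FFor ''c'' 0 ?c) M1)"
    proof (rule run_For_invariant[where I = ?I'])
      show "M1 ''input'' 0 = m" using s by (simp add: greedy_memory_def tables_ok_def input_ok_def)
      show "?I' 0 M1" using s by simp
      fix c M2 assume c: "c < m" "?I' c M2" "M2 ''c'' 0 = c"
      have g: "greedy_memory p M2" and s2: "M2 ''s'' 0 = s" using c(2) by blast+
      note r = run_test_push[OF g s2 s(1) c(3,1)]
      have "run ?c M2 ''s'' 0 = s" using s2 by (simp add: run_not_written)
      moreover have "s \<notin> active (run ?c M2)" if "?cov s c"
        using r(2,3) covers_neighbours_antimono[OF that] c(2) by blast
      ultimately show "?I' (Suc c) (run ?c M2)"
        using r(1,2) c(2) unfolding less_Suc_eq by blast
    next
      fix k v M2 assume "?I' k M2"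
      then show "?I' k (set_var ''c'' v M2)" using greedy_memory_set_var[of "''c''" p v M2] by simp
    qed auto
    then show "?I (Suc s) (run (FFor ''c'' 0 ?c) M1)"
      unfolding less_Suc_eq by blast
  next
    fix k v M2 assume "?I k M2"
    then show "?I k (set_var ''s'' v M2)" using greedy_memory_set_var[of "''s''" p v M2] by simp
  qed auto
  then show "greedy_memory p (run sweep_prog M)" "active (run sweep_prog M) \<subseteq> active M"
    "\<And>s c. s < n \<Longrightarrow> c < m \<Longrightarrow> ?cov s c \<Longrightarrow> s \<notin> active (run sweep_prog M)"
    by blast+
qed

lemma run_init_prog:
  assumes M: "tables_ok p M"
  shows "greedy_memory p (run init_prog M)" "active (run init_prog M) = {..<n}"
proof -
  let ?M1 = "run (FSeq (FWrite ''sol'' (Const 0) (Const 1)) (FWrite ''sol'' (Const 1) (V ''p''))) M"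
  have M1: "?M1 y = M y" if "y \<noteq> ''sol''" for y
    using that by (intro run_not_written) simp
  let ?I = "\<lambda>k M'. \<forall>s<k. M' ''act'' s \<noteq> 0"
  have "?I n (run (FFor ''s'' 1 (FWrite ''act'' (V ''s'') (Const 1))) ?M1)"
  proof (rule run_For_invariant[where I = ?I])
    show "?M1 ''input'' 1 = n" using M M1 by (simp add: tables_ok_def input_ok_def)
  qed (auto simp: less_Suc_eq)
  then show act: "active (run init_prog M) = {..<n}"
    by (auto simp: init_prog_def active_def)
  have "run init_prog M ''sol'' = ?M1 ''sol''"
    unfolding init_prog_def run.simps(3) by (rule run_not_written) simp
  moreover have "?M1 ''sol'' 0 = 1" "?M1 ''sol'' 1 = p"
    using M by (simp_all add: tables_ok_def)
  ultimately have "stored_list (run init_prog M) ''sol'' = [p]"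
    by (simp add: stored_list_def)
  moreover have "tables_ok p (run init_prog M)"
    using M tables_ok_cong[of "run init_prog M" M] by (simp add: run_not_written)
  ultimately show "greedy_memory p (run init_prog M)"
    using greedy_state_init[of p m F n] act M by (simp add: greedy_memory_def tables_ok_def)
qed

text \<open>Each sweep hits a curve as long as one is active, so \<open>n\<close> sweeps leave
  none.\<close>

lemma run_greedy:
  assumes M: "tables_ok p M"
    and progress: "\<And>J. J \<subseteq> {..<n} \<Longrightarrow> J \<noteq> {} \<Longrightarrow> \<exists>s c. c < m \<and> covers_neighbours F m p J s c"
  shows "greedy_state F m n p {} (stored_list (run (FSeq init_prog (FFor ''r'' 1 sweep_prog)) M) ''sol'')"
proof -
  let ?M1 = "run init_prog M"
  note init = run_init_prog[OF M]
  let ?I = "\<lambda>k M'. greedy_memory p M' \<and> card (active M') \<le> n - k"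
  have "?I n (run (FFor ''r'' 1 sweep_prog) ?M1)"
  proof (rule run_For_invariant[where I = ?I])
    show "?M1 ''input'' 1 = n" using init by (simp add: greedy_memory_def tables_ok_def input_ok_def)
    show "?I 0 ?M1" using init by simp
    fix k M' assume k: "k < n" "?I k M'" "M' ''r'' 0 = k"
    have g: "greedy_memory p M'" using k(2) by simp
    note r = run_sweep_prog[OF g]
    have fin: "finite (active M')" by (simp add: active_def)
    have "card (active (run sweep_prog M')) \<le> n - Suc k"
    proof (cases "active M' = {}")
      case True
      then show ?thesis using r(2) by simp
    next
      case False
      moreover have "active M' \<subseteq> {..<n}" by (auto simp: active_def)
      ultimately obtain s c where sc: "c < m" "covers_neighbours F m p (active M') s c"
        using progress by blast
      then have "s \<in> active M'" by (simp add: covers_neighbours_def)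
      moreover from this have "s < n" by (simp add: active_def)
      ultimately have "active (run sweep_prog M') \<subset> active M'" using r(2,3) sc by blast
      then have "card (active (run sweep_prog M')) < card (active M')"
        using fin by (intro psubset_card_mono)
      then show ?thesis using k(2)[THEN conjunct2] by linarith
    qed
    then show "?I (Suc k) (run sweep_prog M')" using r(1) by simp
  next
    fix k v M' assume "?I k M'"
    then show "?I k (set_var ''r'' v M')" using greedy_memory_set_var[of "''r''" p v M'] by simp
  qed auto
  moreover have "finite (active M')" for M' by (simp add: active_def)
  ultimately show ?thesis by (auto simp: greedy_memory_def simp del: run.simps(5))
qed

lemma run_save_prog:
  assumes "M ''input'' 1 = n" "0 < n" "M ''sol'' 0 \<le> Suc n"
  shows "stored_list (run save_prog M) ''output'' =
    (if M ''sol'' 0 < M ''output'' 0 then stored_list M ''sol'' else stored_list M ''output'')"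
proof (cases "M ''sol'' 0 < M ''output'' 0")
  case True
  let ?M1 = "run (FSeq (FWrite ''output'' (Const 0) (V ''sol''))
      (FWrite ''output'' (Const 1) (Read ''sol'' (Const 1)))) M"
  let ?I = "\<lambda>k M'. M' ''sol'' = M ''sol'' \<and> (\<forall>i<Suc (Suc k). M' ''output'' i = M ''sol'' i)"
  have "?I n (run (FFor ''i'' 1 (FWrite ''output'' (Add (V ''i'') (Const 2)) (Read ''sol'' (Add (V ''i'') (Const 2))))) ?M1)"
  proof (rule run_For_invariant[where I = ?I])
    show "?M1 ''input'' 1 = n" using assms by simp
    show "?I 0 ?M1" by (auto simp: less_Suc_eq)
  qed (auto simp: less_Suc_eq)
  then have "?I n (run save_prog M)" using True by (simp add: save_prog_def del: run.simps(5))
  then show ?thesis using True assms(3) by (auto simp: stored_list_def)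
qed (simp add: save_prog_def)

text \<open>\<open>k\<close> counts the start cells tried. Before the first, \<open>output\<close>
  holds only the sentinel and describes no solution, hence the split on \<open>k\<close>.\<close>

definition best_memory :: "nat \<Rightarrow> memory \<Rightarrow> bool" where
  "best_memory k M \<longleftrightarrow> input_ok M \<and> (\<forall>c<m. M ''row'' c = c * n) \<and>
     (k = 0 \<longrightarrow> M ''output'' 0 = n + 2) \<and>
     (0 < k \<longrightarrow> (\<exists>p<m. greedy_state F m n p {} (stored_list M ''output''))) \<and>
     (\<forall>p<k. \<exists>js. greedy_state F m n p {} js \<and> length (stored_list M ''output'') \<le> length js)"

lemma run_candidate_prog:
  assumes M: "best_memory p M" "M ''p'' 0 = p" "p < m" "0 < n"
    and progress: "\<And>J. J \<subseteq> {..<n} \<Longrightarrow> J \<noteq> {} \<Longrightarrow> \<exists>s c. c < m \<and> covers_neighbours F m p J s c"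
  shows "best_memory (Suc p) (run candidate_prog M)"
proof -
  let ?M1 = "run (FSeq init_prog (FFor ''r'' 1 sweep_prog)) M"
  let ?M2 = "run candidate_prog M"
  let ?js = "stored_list ?M1 ''sol''"
  have ok: "tables_ok p M" using M by (simp add: tables_ok_def best_memory_def)
  have js: "greedy_state F m n p {} ?js" by (rule run_greedy[OF ok progress])
  have M1: "?M1 y = M y" if "y \<in> {''input'', ''row'', ''p'', ''output''}" for y
    using that by (intro run_not_written) auto
  have M2: "?M2 y = M y" if "y \<in> {''input'', ''row''}" for y
    using that by (intro run_not_written) (auto simp: candidate_prog_def)
  have len: "?M1 ''sol'' 0 = length ?js" "M ''output'' 0 = length (stored_list M ''output'')"
    by (simp_all add: stored_list_def)
  have lenjs: "length ?js \<le> Suc n" using greedy_state_length[OF js] .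
  have inp: "?M1 ''input'' 1 = n" using ok M1 by (simp add: tables_ok_def input_ok_def)
  have out1: "stored_list ?M1 ''output'' = stored_list M ''output''"
    using M1 by (intro stored_list_cong) simp
  have "?M2 = run save_prog ?M1" by (simp add: candidate_prog_def)
  then have out: "stored_list ?M2 ''output'' =
      (if length ?js < length (stored_list M ''output'') then ?js else stored_list M ''output'')"
    using run_save_prog[of ?M1, OF inp M(4)] lenjs len M1[of "''output''"] out1 by simp
  have "input_ok ?M2" "\<forall>c<m. ?M2 ''row'' c = c * n"
    using M(1) M2 by (simp_all add: best_memory_def input_ok_def)
  moreover have "\<exists>p<m. greedy_state F m n p {} (stored_list ?M2 ''output'')"
  proof (cases "p = 0")
    case True
    then have "length ?js < length (stored_list M ''output'')"
      using M(1) lenjs len(2) by (simp add: best_memory_def)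
    then show ?thesis using out js M(3) by auto
  next
    case False
    then show ?thesis using out js M(1,3) by (auto simp: best_memory_def)
  qed
  moreover have "\<exists>js. greedy_state F m n q {} js \<and> length (stored_list ?M2 ''output'') \<le> length js"
    if q: "q < Suc p" for q
  proof (cases "q = p")
    case True
    then show ?thesis using js out by (intro exI[of _ ?js]) auto
  next
    case False
    then have "q < p" using q by simp
    then obtain js' where "greedy_state F m n q {} js'" "length (stored_list M ''output'') \<le> length js'"
      using M(1) unfolding best_memory_def by blast
    then show ?thesis using out by (intro exI[of _ js']) auto
  qed
  ultimately show ?thesis by (simp add: best_memory_def)
qed

lemma run_main_prog:
  assumes M: "input_ok M" "M ''row'' 0 = 0" "M ''output'' 0 = 0" and "0 < m"
    and progress: "\<And>p J. p < m \<Longrightarrow> J \<subseteq> {..<n} \<Longrightarrow> J \<noteq> {} \<Longrightarrow>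
          \<exists>s c. c < m \<and> covers_neighbours F m p J s c"
  shows "n = 0 \<Longrightarrow> output_of (run main_prog M) = []"
    "0 < n \<Longrightarrow> \<exists>p<m. greedy_state F m n p {} (output_of (run main_prog M))"
    "\<And>p. 0 < n \<Longrightarrow> p < m \<Longrightarrow> \<exists>js. greedy_state F m n p {} js \<and> length (output_of (run main_prog M)) \<le> length js"
proof -
  let ?M1 = "run rows_prog M"
  have M1: "?M1 y = M y" if "y \<in> {''input'', ''p'', ''output''}" for y
    using that by (intro run_not_written) auto
  have inp: "input_ok ?M1" "?M1 ''input'' (Suc 0) = n" using M(1) M1 by (simp_all add: input_ok_def)
  show "output_of (run main_prog M) = []" if "n = 0"
    using that inp M(3) M1[of "''output''"]
    by (simp add: main_prog_def output_of_stored_list stored_list_def)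
  have best: "best_memory m (run main_prog M)" if "0 < n"
  proof -
    let ?M2 = "run (FWrite ''output'' (Const 0) (Add (Read ''input'' (Const 1)) (Const 2))) ?M1"
    have "best_memory m (run (FFor ''p'' 0 candidate_prog) ?M2)"
    proof (rule run_For_invariant[where I = best_memory])
      show "?M2 ''input'' 0 = m" using inp by (simp add: input_ok_def)
      show "best_memory 0 ?M2"
        using inp run_rows_prog[OF M(1,2)] by (simp add: best_memory_def input_ok_def)
      show "best_memory (Suc k) (run candidate_prog M')"
        if "k < m" "best_memory k M'" "M' ''p'' 0 = k" for k M'
        using run_candidate_prog[OF that(2,3,1) \<open>0 < n\<close>] progress that(1) by blast
      show "best_memory k (set_var ''p'' v M')" if "best_memory k M'" for k v M'
        using that stored_list_cong[of "set_var ''p'' v M'" "''output''" M']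
        by (simp add: best_memory_def input_ok_def)
    qed (auto simp: candidate_prog_def)
    then show ?thesis using inp that by (simp add: main_prog_def del: run.simps(5))
  qed
  show "\<exists>p<m. greedy_state F m n p {} (output_of (run main_prog M))" if "0 < n"
    using best[OF that] \<open>0 < m\<close> by (simp add: best_memory_def output_of_stored_list)
  show "\<exists>js. greedy_state F m n p {} js \<and> length (output_of (run main_prog M)) \<le> length js"
    if "0 < n" "p < m" for p
    using best[OF that(1)] that(2) by (simp add: best_memory_def output_of_stored_list)
qed

end


section \<open>Correctness on encoded arrangements\<close>

lemma length_concat_map: "length (concat (map (\<lambda>x. map (f x) ys) xs)) = length xs * length ys"
  by (induction xs) auto

lemma nth_concat_map:
  "i < length xs \<Longrightarrow> j < length ys \<Longrightarrow>
     concat (map (\<lambda>x. map (f x) ys) xs) ! (i * length ys + j) = f (xs ! i) (ys ! j)"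
proof (induction xs arbitrary: i)
  case (Cons x xs)
  then show ?case by (cases i) (auto simp: nth_append)
qed simp

lemma input_ok_code_of:
  "input_ok (length Cs) (length Ss) (table (Ss, Cs)) (input_memory (code_of (Ss, Cs)))"
proof -
  let ?rows = "concat (map (\<lambda>C. map (\<lambda>S. of_bool (C \<subseteq> inside S)) Ss) Cs) :: nat list"
  have "input_memory (code_of (Ss, Cs)) ''input'' (c * length Ss + (s + 2)) = of_bool (table (Ss, Cs) c s)"
    if "c < length Cs" "s < length Ss" for c s
  proof -
    have "c * length Ss + s < Suc c * length Ss" using that(2) by simp
    also have "\<dots> \<le> length Cs * length Ss" using that(1) by (intro mult_le_mono1) simp
    finally have "c * length Ss + s < length ?rows" by (simp only: length_concat_map)
    moreover have "?rows ! (c * length Ss + s) = of_bool (table (Ss, Cs) c s)"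
      unfolding table_def fst_conv snd_conv by (rule nth_concat_map[OF that])
    ultimately show ?thesis by (simp add: code_of_def input_memory_def)
  qed
  then show ?thesis
    by (simp add: input_ok_def) (simp add: code_of_def input_memory_def)
qed

context presented_arrangement
begin

abbreviation "m \<equiv> length Cs"
abbreviation "n \<equiv> length Ss"
abbreviation "F \<equiv> table (Ss, Cs)"

lemma one_cell_if_no_curves:
  assumes "n = 0"
  shows "m = 1"
proof -
  have "set Cs = {UNIV}" using presented(2,4) assms by (simp add: cells_def)
  then show ?thesis using distinct_card[OF presented(3)] by simp
qed

lemma cells_pos: "0 < m"
  using ex_cell_with_sides by (metis gr_implies_not0 neq0_conv)

text \<open>Makes the length of the code an admissible \<open>N\<close> in
  \<open>exec_compile\<close>.\<close>

lemma sizes_le_code: "m \<le> length (code_of (Ss, Cs))" "n \<le> length (code_of (Ss, Cs))"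
proof -
  have len: "length (code_of (Ss, Cs)) = 2 + m * n"
    by (simp only: code_of_def prod.case length_append length_concat_map) simp
  show "n \<le> length (code_of (Ss, Cs))" unfolding len using cells_pos by (cases m) auto
  show "m \<le> length (code_of (Ss, Cs))" unfolding len using one_cell_if_no_curves by (cases n) auto
qed

lemma hits_both_sides_iff:
  "hits_both_sides \<S> P \<longleftrightarrow> (\<forall>s<n. P \<inter> inside (Ss ! s) \<noteq> {} \<and> P \<inter> outside (Ss ! s) \<noteq> {})"
  unfolding hits_both_sides_def presented(2)[symmetric] all_set_conv_all_nth ..

text \<open>Optimality must hold against points on curves too. \<open>ex_cell_with_sides\<close>
  trades each point for a cell, so it is enough to compare with sets of cells.\<close>

lemma separating_cells_of_hitting_set:
  assumes "finite Q" "hits_both_sides \<S> Q"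
  obtains D where "D \<subseteq> {..<m}" "card D \<le> card Q" "\<forall>s<n. \<exists>i\<in>D. \<exists>j\<in>D. F i s \<noteq> F j s"
proof -
  have "\<forall>q. \<exists>d<m. \<forall>s<n. (q \<in> inside (Ss ! s) \<longrightarrow> F d s) \<and> (q \<in> outside (Ss ! s) \<longrightarrow> \<not> F d s)"
    using ex_cell_with_sides by metis
  then obtain f where f: "\<And>q. f q < m"
    "\<And>q s. s < n \<Longrightarrow> q \<in> inside (Ss ! s) \<Longrightarrow> F (f q) s"
    "\<And>q s. s < n \<Longrightarrow> q \<in> outside (Ss ! s) \<Longrightarrow> \<not> F (f q) s"
    by metis
  show thesis
  proof
    show "f ` Q \<subseteq> {..<m}" using f(1) by auto
    show "card (f ` Q) \<le> card Q" using assms(1) by (rule card_image_le)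
    show "\<forall>s<n. \<exists>i\<in>f ` Q. \<exists>j\<in>f ` Q. F i s \<noteq> F j s"
    proof (intro allI impI)
      fix s assume s: "s < n"
      then obtain x y where "x \<in> Q" "x \<in> inside (Ss ! s)" "y \<in> Q" "y \<in> outside (Ss ! s)"
        using assms(2) unfolding hits_both_sides_iff by blast
      then show "\<exists>i\<in>f ` Q. \<exists>j\<in>f ` Q. F i s \<noteq> F j s"
        using f(2,3)[OF s] by blast
    qed
  qed
qed

lemma hits_both_sides_of_cells:
  assumes js: "js \<subseteq> {..<m}" "\<And>s. s < n \<Longrightarrow> \<exists>i\<in>js. \<exists>j\<in>js. F i s \<noteq> F j s"
    and q: "\<And>j. j \<in> js \<Longrightarrow> q j \<in> Cs ! j"
  shows "hits_both_sides \<S> (q ` js)"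
  unfolding hits_both_sides_iff
proof (intro allI impI)
  fix s assume s: "s < n"
  then obtain i j where ij: "i \<in> js" "j \<in> js" "F i s" "\<not> F j s" using js(2) by metis
  have "i < m" "j < m" using ij(1,2) js(1) by auto
  then have "q i \<in> inside (Ss ! s)" "q j \<in> outside (Ss ! s)"
    using cell_side[OF _ s q] ij by simp_all
  then show "q ` js \<inter> inside (Ss ! s) \<noteq> {} \<and> q ` js \<inter> outside (Ss ! s) \<noteq> {}"
    using ij(1,2) by blast
qed

lemma ex_covers_neighbours:
  assumes "simple_arrangement \<S>" "non_separating \<S>" "p < m" "J \<subseteq> {..<n}" "J \<noteq> {}"
  shows "\<exists>s c. c < m \<and> covers_neighbours F m p J s c"
  using table_simplicial[OF assms] unfolding covers_neighbours_def share_def far_def by blast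

lemma greedy_output_correct:
  assumes js: "n = 0 \<Longrightarrow> js = []" "0 < n \<Longrightarrow> \<exists>p<m. greedy_state F m n p {} js"
    and best: "\<And>p. 0 < n \<Longrightarrow> p < m \<Longrightarrow> \<exists>js'. greedy_state F m n p {} js' \<and> length js \<le> length js'"
  shows "\<exists>P. point_set_described (Ss, Cs) js P"
    "point_set_described (Ss, Cs) js P \<Longrightarrow> minimum_hitting_set \<S> P"
proof -
  have dist: "distinct js" and sub: "set js \<subseteq> {..<m}"
    using js by (cases "n = 0"; auto simp: greedy_state_def)+
  have sep: "\<exists>i\<in>set js. \<exists>j\<in>set js. F i s \<noteq> F j s" if "s < n" for s
    using js(2) greedy_state_final[OF _ that] that by (metis gr_implies_not0 neq0_conv)
  have "\<exists>q. \<forall>j\<in>set js. q j \<in> Cs ! j"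
    using cell_nonempty sub by (intro bchoice) auto
  then show "\<exists>P. point_set_described (Ss, Cs) js P"
    using dist sub by (auto simp: point_set_described_def)
  assume "point_set_described (Ss, Cs) js P"
  then obtain q where q: "\<And>j. j \<in> set js \<Longrightarrow> q j \<in> Cs ! j" and P: "P = q ` set js"
    by (auto simp: point_set_described_def)
  have card_P: "card P \<le> length js"
    unfolding P using card_image_le[of "set js" q] card_length[of js] by simp
  have "card P \<le> card Q" if Q: "finite Q" "hits_both_sides \<S> Q" for Q
  proof (cases "n = 0")
    case True
    then show ?thesis using js(1) card_P by simp
  next
    case False
    obtain D where D: "D \<subseteq> {..<m}" "card D \<le> card Q"
      "\<forall>s<n. \<exists>i\<in>D. \<exists>j\<in>D. F i s \<noteq> F j s"
      using separating_cells_of_hitting_set[OF Q] .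
    \<comment> \<open>There is a curve, so \<open>D\<close> is nonempty. The greedy run that starts
      at a member of \<open>D\<close> is the one to compare with.\<close>
    obtain p where "p \<in> D" using D(3) False by blast
    then obtain js' where js': "greedy_state F m n p {} js'" "length js \<le> length js'"
      using best[of p] D(1) False by auto
    have "length js' \<le> card D"
      using D(3) by (intro greedy_state_optimal[OF js'(1) D(1) \<open>p \<in> D\<close>]) blast
    then show ?thesis using card_P js'(2) D(2) by linarith
  qed
  moreover have "hits_both_sides \<S> P"
    unfolding P using sub sep q by (rule hits_both_sides_of_cells)
  ultimately show "minimum_hitting_set \<S> P" unfolding minimum_hitting_set_def P by simp
qed

end

theorem theorem5:
  shows "solvable_in_polynomial_time
    {A. \<exists>\<S>. simple_arrangement \<S> \<and> non_separating \<S> \<and> presents A \<S>}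
    code_of
    (\<lambda>A js. (\<exists>P. point_set_described A js P) \<and>
       (\<forall>\<S> P. presents A \<S> \<and> point_set_described A js P \<longrightarrow> minimum_hitting_set \<S> P))"
  unfolding solvable_in_polynomial_time_def
proof (rule exI[of _ "compile main_prog"], rule exI[of _ "time_bound main_prog"], rule ballI)
  fix A assume "A \<in> {A. \<exists>\<S>. simple_arrangement \<S> \<and> non_separating \<S> \<and> presents A \<S>}"
  then obtain \<S> where S: "simple_arrangement \<S>" "non_separating \<S>" "presents A \<S>" by blast
  obtain Ss Cs where A: "A = (Ss, Cs)" by (cases A)
  interpret presented_arrangement Ss Cs \<S>
    using S A by unfold_locales (auto simp: simple_arrangement_def)
  define M where "M = input_memory (code_of A)"
  have inp: "input_ok m n F M" unfolding M_def A by (rule input_ok_code_of)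
  then have "\<exists>t\<le>poly (time_bound main_prog) (length (code_of A)).
      exec (compile main_prog) M t (run main_prog M)"
    using sizes_le_code by (intro exec_compile wf_main_prog) (simp_all add: input_ok_def A)
  then obtain t where t: "t \<le> poly (time_bound main_prog) (length (code_of A))"
    "exec (compile main_prog) M t (run main_prog M)" by blast
  let ?js = "output_of (run main_prog M)"
  have "M ''row'' 0 = 0" "M ''output'' 0 = 0" by (simp_all add: M_def input_memory_def)
  note out = run_main_prog[OF inp this cells_pos ex_covers_neighbours[OF S(1,2)]]
  have correct: "\<exists>P. point_set_described A ?js P"
    "\<And>P. point_set_described A ?js P \<Longrightarrow> minimum_hitting_set \<S> P"
    unfolding A using greedy_output_correct[of ?js] out by blast+
  \<comment> \<open>The presentation lists the curves and so determines the arrangement.\<close>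
  have "\<S>' = \<S>" if "presents A \<S>'" for \<S>'
    using that S(3) by (auto simp: A presents_def)
  with correct t show "\<exists>t M. exec (compile main_prog) (input_memory (code_of A)) t M \<and>
      t \<le> poly (time_bound main_prog) (length (code_of A)) \<and>
      (\<exists>P. point_set_described A (output_of M) P) \<and>
      (\<forall>\<S> P. presents A \<S> \<and> point_set_described A (output_of M) P \<longrightarrow> minimum_hitting_set \<S> P)"
    unfolding M_def by blast
qed

end
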